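(* Suppose that $\omega:[0,+\infty)\to(0,+\infty)$ is a weight function, $d\ge 1$, $g\in\mathcal{H}ol(\mathbb{C}^d)$, $\varphi:\mathbb{C}^d\to\mathbb{C}^d$ is a holomorphic map, and $\mathcal{L}(\mathbb{C}^d)$ is a lattice. Then the weighted composition operator $C_\varphi^g$, $C_\varphi^g f(z)=g(z)f(\varphi(z))$, maps $\mathcal{A}^\omega(\mathbb{C}^d)$ into $\mathcal{L}(\mathbb{C}^d)$ if and only if the function $z\mapsto |g(z)|\,\widetilde{\omega}(|\varphi(z)|)$ belongs to $\mathcal{L}(\mathbb{C}^d)$, where $\widetilde{\omega}$ denotes the associated weight function of $\omega$.
   Context: $\mathcal{H}ol(\mathbb{C}^d)$ is the space of entire functions on $\mathbb{C}^d$. A weight function is a non-decreasing, continuous, unbounded function $\omega:[0,+\infty)\to(0,+\infty)$; it is always assumed in addition that $\lim_{t\to+\infty}t^{-k}\omega(t)=\infty$ for all $k\in\mathbb{N}$. The growth space $\mathcal{A}^\omega(\mathbb{C}^d)$ consists of those $f\in\mathcal{H}ol(\mathbb{C}^d)$ with $\|f\|_{\mathcal{A}^\omega}=\sup_{z\in\mathbb{C}^d}|f(z)|/\omega(|z|)<\infty$. The associated weight function $\widetilde{\omega}:[0,+\infty)\to(0,+\infty)$ is defined by $\widetilde{\omega}(|z|)=\sup\{|f(z)|: f\in\mathcal{H}ol(\mathbb{C}),\ |f(w)|\le\omega(|w|)\text{ for all }w\in\mathbb{C}\}$, $z\in\mathbb{C}$ (the supremum depends only on $|z|$; the analogous supremum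 over $\mathcal{H}ol(\mathbb{C}^d)$ yields the same function $\widetilde{\omega}$ for every $d\ge1$). A lattice $\mathcal{L}(\mathbb{C}^d)$ is a linear space whose elements are functions $F:\mathbb{C}^d\to\mathbb{C}$, with the following property: if $f,F:\mathbb{C}^d\to\mathbb{C}$ are continuous functions, $|f(z)|\le|F(z)|$ for all $z\in\mathbb{C}^d$, and $F\in\mathcal{L}(\mathbb{C}^d)$, then $f\in\mathcal{L}(\mathbb{C}^d)$. *)

theory Defs
  imports "HOL-Complex_Analysis.Complex_Analysis"
begin

(* The points of C^d are the vectors of type complex ^ 'n with d = CARD('n); norm is the
   Euclidean norm. Frechet differentiability alone is only real differentiability, hence
   the requirement that the derivative be complex linear. *)
definition entire :: "(complex ^ 'n \<Rightarrow> complex) \<Rightarrow> bool" where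
  "entire f \<longleftrightarrow>
     (\<forall>z. \<exists>D. (f has_derivative D) (at z) \<and> Vector_Spaces.linear (*s) (*) D)"

definition holomorphic_map :: "(complex ^ 'n \<Rightarrow> complex ^ 'm) \<Rightarrow> bool" where
  "holomorphic_map \<phi> \<longleftrightarrow> (\<forall>i. entire (\<lambda>z. \<phi> z $ i))"

(* Only the values of \<omega> on [0, \<infinity>) are constrained, and only those are ever used. *)
definition weight_function :: "(real \<Rightarrow> real) \<Rightarrow> bool" where
  "weight_function \<omega> \<longleftrightarrow>
     (\<forall>t\<ge>0. \<omega> t > 0) \<and>
     mono_on {0..} \<omega> \<and>
     continuous_on {0..} \<omega> \<and>
     \<not> bdd_above (\<omega> ` {0..}) \<and>
     (\<forall>k::nat. filterlim (\<lambda>t. \<omega> t / t ^ k) at_top at_top)"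

definition growth_space :: "(real \<Rightarrow> real) \<Rightarrow> (complex ^ 'n \<Rightarrow> complex) set" where
  "growth_space \<omega> = {f. entire f \<and> bdd_above (range (\<lambda>z. cmod (f z) / \<omega> (norm z)))}"

(* The supremum is taken at the point z = t; by assoc_weight_cmod below it is the same
   at every z with |z| = t. *)
definition assoc_weight :: "(real \<Rightarrow> real) \<Rightarrow> real \<Rightarrow> real" where
  "assoc_weight \<omega> t =
     Sup {cmod (f (complex_of_real t)) |f.
            f holomorphic_on UNIV \<and> (\<forall>w. cmod (f w) \<le> \<omega> (cmod w))}"

lemma assoc_weight_cmod:
  "assoc_weight \<omega> (cmod z) =
     Sup {cmod (f z) |f. f holomorphic_on UNIV \<and> (\<forall>w. cmod (f w) \<le> \<omega> (cmod w))}"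
proof -
  let ?B = "\<lambda>f. f holomorphic_on UNIV \<and> (\<forall>w. cmod (f w) \<le> \<omega> (cmod w))"
  have sub: "{cmod (f a) |f. ?B f} \<subseteq> {cmod (f b) |f. ?B f}" if "cmod a = cmod b" for a b
  proof -
    obtain u where u: "cmod u = 1" "a = u * b"
    proof (cases "b = 0")
      case True
      then show thesis using that[of 1] \<open>cmod a = cmod b\<close> by auto
    next
      case False
      then show thesis using that[of "a / b"] \<open>cmod a = cmod b\<close> by (auto simp: norm_divide)
    qed
    show ?thesis
    proof clarify
      fix f assume f: "f holomorphic_on UNIV" "\<forall>w. cmod (f w) \<le> \<omega> (cmod w)"
      have "(f \<circ> (\<lambda>w. u * w)) holomorphic_on UNIV"
        by (intro holomorphic_on_compose holomorphic_intros holomorphic_on_subset[OF f(1)]) auto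
      moreover have "cmod (f (u * w)) \<le> \<omega> (cmod w)" for w
        using f(2)[rule_format, of "u * w"] u(1) by (simp add: norm_mult)
      ultimately show "\<exists>h. cmod (f a) = cmod (h b) \<and> ?B h"
        using u(2) by (intro exI[of _ "f \<circ> (\<lambda>w. u * w)"]) auto
    qed
  qed
  show ?thesis
    unfolding assoc_weight_def
    using sub[of "complex_of_real (cmod z)" z] sub[of z "complex_of_real (cmod z)"]
    by (intro arg_cong[where f = Sup] equalityI) auto
qed

(* The first three clauses say that L is a complex linear space. *)
definition lattice :: "(complex ^ 'n \<Rightarrow> complex) set \<Rightarrow> bool" where
  "lattice L \<longleftrightarrow>
     (\<lambda>z. 0) \<in> L \<and>
     (\<forall>F\<in>L. \<forall>G\<in>L. (\<lambda>z. F z + G z) \<in> L) \<and>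
     (\<forall>c. \<forall>F\<in>L. (\<lambda>z. c * F z) \<in> L) \<and>
     (\<forall>f F. continuous_on UNIV f \<longrightarrow> continuous_on UNIV F \<longrightarrow>
        (\<forall>z. cmod (f z) \<le> cmod (F z)) \<longrightarrow> F \<in> L \<longrightarrow> f \<in> L)"

definition weighted_composition ::
  "(complex ^ 'n \<Rightarrow> complex) \<Rightarrow> (complex ^ 'n \<Rightarrow> complex ^ 'n) \<Rightarrow>
   (complex ^ 'n \<Rightarrow> complex) \<Rightarrow> (complex ^ 'n \<Rightarrow> complex)" where
  "weighted_composition g \<phi> f = (\<lambda>z. g z * f (\<phi> z))"

end

theory Submission imports Defs begin

text \<open>If \<open>f \<in> growth_space \<omega>\<close>, restricting \<open>f\<close> to complex lines gives
  \<open>|f z| \<le> C * assoc_weight \<omega> |z|\<close>, so the lattice property yields one direction.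
  For the other one it suffices to find finitely many \<open>f j\<close> in the growth space whose moduli add up
  to at least a multiple of the associated weight.

  Let \<open>a n\<close> be the minimum of \<open>\<omega> t / t ^ n\<close>. Cauchy estimates at the minimisers and the maximum
  principle on annuli show that the associated weight is comparable to \<open>max n. a n * t ^ n\<close>. As
  \<open>a\<close> is log-concave, one can thin out the exponents so that this maximum is preserved up to a
  factor while, for each \<open>t\<close>, the remaining terms decay geometrically away from the largest one.
  Splitting the thinned series into residue classes modulo a large \<open>M\<close>, and replacing \<open>t ^ n\<close> by
  polynomials \<open>p n j\<close> of degree \<open>n\<close> with \<open>|p n j z| \<le> |z| ^ n\<close> whose moduli add up to at least
  \<open>\<delta> * |z| ^ n\<close>, gives the functions \<open>f j\<close>. The polynomials are themselves obtained by the same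
  lacunary construction, adding one coordinate at a time.\<close>

section \<open>Entire functions of several variables\<close>

lemma complex_linear_iff:
  "Vector_Spaces.linear (*s) (*) (D :: complex ^ 'n \<Rightarrow> complex) \<longleftrightarrow>
     (\<forall>x y. D (x + y) = D x + D y) \<and> (\<forall>c x. D (c *s x) = c * D x)"
  unfolding Vector_Spaces.linear_iff
  by (auto intro: vec.vector_space_axioms vector_space_over_itself.vector_space_axioms)

lemma entire_const: "entire (\<lambda>z. c)"
  unfolding entire_def complex_linear_iff
  by (intro allI exI[of _ "\<lambda>_. 0"]) auto

lemma entire_component: "entire (\<lambda>z. z $ i)"
  unfolding entire_def complex_linear_iff
  by (intro allI exI[of _ "\<lambda>h. h $ i"])
    (auto intro: bounded_linear_imp_has_derivative bounded_linear_vec_nth)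

lemma entire_mult:
  assumes "entire f" "entire g"
  shows "entire (\<lambda>z. f z * g z)"
  unfolding entire_def
proof
  fix z
  obtain D E where "(f has_derivative D) (at z)" "Vector_Spaces.linear (*s) (*) D"
    "(g has_derivative E) (at z)" "Vector_Spaces.linear (*s) (*) E"
    using assms unfolding entire_def by metis
  then show "\<exists>D. ((\<lambda>z. f z * g z) has_derivative D) (at z) \<and> Vector_Spaces.linear (*s) (*) D"
    unfolding complex_linear_iff
    by (intro exI[of _ "\<lambda>h. f z * E h + D h * g z"])
      (intro conjI has_derivative_mult; simp add: algebra_simps)
qed

lemma entire_power: "entire f \<Longrightarrow> entire (\<lambda>z. f z ^ n)"
  by (induction n) (simp_all add: entire_const entire_mult)

lemma entire_continuous: "entire f \<Longrightarrow> continuous_on S f"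
  unfolding entire_def
  by (meson continuous_at_imp_continuous_on has_derivative_continuous)

text \<open>Complex linearity turns the real chain rule into a complex one, since
  \<open>D (h *s v) = h * D v\<close>.\<close>

lemma entire_line:
  fixes f :: "complex ^ 'n \<Rightarrow> complex"
  assumes "(f has_derivative D) (at (u + w *s v))" "Vector_Spaces.linear (*s) (*) D"
  shows "((\<lambda>\<zeta>. f (u + \<zeta> *s v)) has_field_derivative D v) (at w)"
proof -
  have "bounded_linear (\<lambda>h::complex. h *s v)"
    by (intro linear_conv_bounded_linear[THEN iffD1] linearI)
      (auto simp: vec_eq_iff algebra_simps)
  then have "((\<lambda>\<zeta>. u + \<zeta> *s v) has_derivative (\<lambda>h. 0 + h *s v)) (at w)"
    by (intro has_derivative_add has_derivative_const bounded_linear_imp_has_derivative)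
  from has_derivative_compose[OF this assms(1)]
  show ?thesis
    unfolding has_field_derivative_def
    using assms(2) by (simp add: complex_linear_iff mult_commute_abs)
qed

lemma entire_line_holomorphic:
  assumes "entire f"
  shows "(\<lambda>\<zeta>. f (u + \<zeta> *s v)) holomorphic_on S"
  unfolding holomorphic_on_def field_differentiable_def
  using assms entire_line[of f _ u _ v] unfolding entire_def
  by (metis has_field_derivative_at_within)

lemma norm_vector_scalar_mult: "norm (c *s (v::complex ^ 'n)) = cmod c * norm v"
  by (simp add: norm_vec_def L2_set_def norm_mult power_mult_distrib sum_distrib_left[symmetric]
      real_sqrt_mult)

lemma holomorphic_deriv_bound:
  assumes "f holomorphic_on UNIV" "\<And>w. cmod (w - z) = 1 \<Longrightarrow> cmod (f w) \<le> B"
    "(f has_field_derivative D) (at z)"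
  shows "cmod D \<le> B"
proof -
  have "cmod ((deriv ^^ 1) f z) \<le> fact 1 * B / 1 ^ 1"
    using assms by (intro Cauchy_inequality)
      (auto intro: holomorphic_on_subset holomorphic_on_imp_continuous_on simp: norm_minus_commute)
  then show ?thesis using DERIV_imp_deriv[OF assms(3)] by simp
qed

text \<open>The Cauchy estimate on the unit circle of the complex line through \<open>z\<close> in
  the direction of \<open>h\<close>.\<close>

lemma entire_derivative_bound:
  assumes f: "entire f" and D: "(f has_derivative D) (at z)" "Vector_Spaces.linear (*s) (*) D"
    and B: "\<And>w. norm w \<le> norm z + 1 \<Longrightarrow> cmod (f w) \<le> B"
  shows "cmod (D h) \<le> B * norm h"
proof (cases "h = 0")
  case True
  then have "D h = 0"
    using D(2) by (metis complex_linear_iff vec.scale_zero_left mult_zero_left)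
  then show ?thesis using True by simp
next
  case False
  define v where "v = complex_of_real (1 / norm h) *s h"
  have v: "norm v = 1" using False by (simp add: v_def norm_vector_scalar_mult norm_divide)
  have "cmod (D v) \<le> B"
  proof (rule holomorphic_deriv_bound)
    show "(\<lambda>\<zeta>. f (z + \<zeta> *s v)) holomorphic_on UNIV" by (rule entire_line_holomorphic[OF f])
    show "((\<lambda>\<zeta>. f (z + \<zeta> *s v)) has_field_derivative D v) (at 0)"
      using D by (intro entire_line) auto
    fix w :: complex assume "cmod (w - 0) = 1"
    then show "cmod (f (z + w *s v)) \<le> B"
      using norm_triangle_ineq[of z "w *s v"] v by (intro B) (simp add: norm_vector_scalar_mult)
  qed
  moreover have "D v = complex_of_real (1 / norm h) * D h"
    using D(2) by (simp add: complex_linear_iff v_def)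
  ultimately show ?thesis using False by (simp add: norm_mult norm_divide field_simps)
qed

text \<open>The majorants pass to the derivatives by \<open>entire_derivative_bound\<close>, so the
  series may be differentiated termwise; complex linearity survives the summation.\<close>

lemma entire_suminf:
  fixes f :: "nat \<Rightarrow> complex ^ 'n \<Rightarrow> complex"
  assumes f: "\<And>k. entire (f k)"
    and B: "\<And>k z R. norm z \<le> R \<Longrightarrow> cmod (f k z) \<le> B k R"
    and s: "\<And>R. R \<ge> 0 \<Longrightarrow> summable (\<lambda>k. B k R)"
  shows "entire (\<lambda>z. \<Sum>k. f k z)"
proof -
  from f obtain D where D: "\<And>k z. (f k has_derivative D k z) (at z)"
      "\<And>k z. Vector_Spaces.linear (*s) (*) (D k z)"
    unfolding entire_def by metis
  have Db: "cmod (D k z h) \<le> B k R * norm h" if "norm z \<le> R - 1" for k z h R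
    by (rule entire_derivative_bound[OF f D B]) (use that in auto)
  have Ds: "summable (\<lambda>k. D k z h)" for z h
  proof (rule summable_comparison_test')
    show "summable (\<lambda>k. B k (norm z + 1) * norm h)"
      by (intro summable_mult2 s) auto
  qed (use Db[of z "norm z + 1"] in auto)
  define g' where "g' z h = (\<Sum>k. D k z h)" for z h
  show ?thesis
    unfolding entire_def
  proof
    fix z0 :: "complex ^ 'n"
    \<comment> \<open>The derivative bounds on the ball of radius \<open>R - 1\<close> use values up
      to radius \<open>R\<close>, and \<open>z0\<close> has to lie inside that ball.\<close>
    define R where "R = norm z0 + 2"
    let ?S = "ball (0::complex ^ 'n) (R - 1)"
    have z0: "z0 \<in> ?S" by (simp add: R_def)
    have R: "R \<ge> 0" by (simp add: R_def)
    have "\<exists>g. \<forall>x\<in>?S. (\<lambda>n. f n x) sums g x \<and> (g has_derivative g' x) (at x within ?S)"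
    proof (rule has_derivative_series)
      fix e :: real assume e: "e > 0"
      obtain N where N: "\<And>n. n \<ge> N \<Longrightarrow> norm (\<Sum>i. B (i + n) R) < e"
        using suminf_exist_split[OF e s[OF R]] by blast
      have "norm ((\<Sum>i<n. D i x h) - g' x h) \<le> e * norm h" if n: "n \<ge> N" and x: "x \<in> ?S" for n x h
      proof -
        have "norm ((\<Sum>i<n. D i x h) - g' x h) = norm (\<Sum>i. D (i + n) x h)"
          using suminf_minus_initial_segment[OF Ds[of x h], of n]
          by (simp add: g'_def norm_minus_commute)
        also have "\<dots> \<le> (\<Sum>i. B (i + n) R * norm h)"
          using x by (intro norm_suminf_le Db summable_mult2 summable_ignore_initial_segment s R) auto
        also have "\<dots> = (\<Sum>i. B (i + n) R) * norm h"
          by (intro suminf_mult2[symmetric] summable_ignore_initial_segment s R)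
        also have "\<dots> \<le> e * norm h"
          using N[OF n] by (intro mult_right_mono) auto
        finally show ?thesis .
      qed
      then show "\<forall>\<^sub>F n in sequentially. \<forall>x\<in>?S. \<forall>h. norm ((\<Sum>i<n. D i x h) - g' x h) \<le> e * norm h"
        unfolding eventually_sequentially by blast
    next
      show "(\<lambda>n. f n z0) sums (\<Sum>n. f n z0)"
        using B[OF order_refl] s[of "norm z0"]
        by (intro summable_sums summable_comparison_test'[OF s[of "norm z0"]]) auto
    qed (use D z0 in \<open>auto intro: has_derivative_at_withinI\<close>)
    then obtain g where g: "\<And>x. x \<in> ?S \<Longrightarrow> (\<lambda>n. f n x) sums g x"
      "\<And>x. x \<in> ?S \<Longrightarrow> (g has_derivative g' x) (at x within ?S)"
      by blast
    have "(g has_derivative g' z0) (at z0)"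
      using g(2)[OF z0] at_within_open[OF z0 open_ball] by simp
    then have "((\<lambda>z. \<Sum>k. f k z) has_derivative g' z0) (at z0)"
      by (rule has_derivative_transform_within_open[OF _ open_ball z0])
        (use g(1) in \<open>simp add: sums_iff\<close>)
    moreover have "Vector_Spaces.linear (*s) (*) (g' z0)"
      using D(2) Ds unfolding complex_linear_iff g'_def
      by (simp add: suminf_add suminf_mult)
    ultimately show "\<exists>D. ((\<lambda>z. \<Sum>k. f k z) has_derivative D) (at z0) \<and>
        Vector_Spaces.linear (*s) (*) D"
      by blast
  qed
qed

section \<open>Lacunary subsequences of log-concave sequences\<close>

text \<open>With truncated subtraction the exponent is the distance of \<open>k\<close> and
  \<open>m\<close>. The indices from \<open>m\<close> on contribute 2, those below \<open>m\<close>
  contribute \<open>1 - (1/2) ^ m\<close>.\<close>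

lemma sums_half_power_dist:
  "(\<lambda>k. (1/2::real) ^ ((k - m) + (m - k))) sums (3 - (1/2) ^ m)"
proof -
  have "(\<lambda>k. (1/2::real) ^ ((k + m - m) + (m - (k + m)))) sums 2"
    using geometric_sums[of "1/2::real"] by simp
  moreover have "(\<Sum>k<m. (1/2::real) ^ ((k - m) + (m - k))) = 1 - (1/2) ^ m"
  proof -
    have "(\<Sum>k<m. (1/2::real) ^ ((k - m) + (m - k))) = (\<Sum>k<m. (1/2) ^ Suc (m - Suc k))"
      by (intro sum.cong) (auto simp: Suc_diff_Suc simp del: power_Suc)
    also have "\<dots> = (\<Sum>k<m. (1/2) ^ Suc k)"
      by (rule sum.nat_diff_reindex)
    also have "\<dots> = 1 - (1/2) ^ m"
      by (induction m) (auto simp: field_simps)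
    finally show ?thesis .
  qed
  ultimately show ?thesis
    using sums_iff_shift[of "\<lambda>k. (1/2::real) ^ ((k - m) + (m - k))" m "2"] by simp
qed

lemma sums_half_power_dist_bound:
  fixes u :: "nat \<Rightarrow> complex"
  assumes "\<And>k. norm (u k) \<le> C * (1/2) ^ ((k - m) + (m - k))" and "C \<ge> 0"
  shows "summable u" "norm (suminf u) \<le> 3 * C"
proof -
  have s: "(\<lambda>k. C * (1/2) ^ ((k - m) + (m - k))) sums (C * (3 - (1/2) ^ m))"
    by (intro sums_mult sums_half_power_dist)
  show "summable u"
    by (rule summable_comparison_test'[OF sums_summable[OF s], of 0]) (use assms in auto)
  have "norm (suminf u) \<le> (\<Sum>k. C * (1/2) ^ ((k - m) + (m - k)))"
    by (rule norm_suminf_le[OF assms(1) sums_summable[OF s]])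
  also have "\<dots> \<le> 3 * C"
    unfolding sums_unique[OF s, symmetric] using assms(2) by (simp add: algebra_simps)
  finally show "norm (suminf u) \<le> 3 * C" .
qed

text \<open>The indices are selected greedily: from \<open>m\<close> one jumps to the largest \<open>n\<close> such that the two terms
  of index \<open>m\<close> and \<open>n\<close> still control, up to the factor \<open>16\<close>, all terms in between for every
  \<open>t > 0\<close>. Maximality forces a drop by this factor over any two consecutive jumps, hence an
  average factor \<open>1/4\<close> per jump.\<close>

definition separated :: "(nat \<Rightarrow> real) \<Rightarrow> nat \<Rightarrow> nat \<Rightarrow> bool" where
  "separated a m n \<longleftrightarrow> (\<exists>s>0. \<exists>p. m < p \<and> p < n \<and>
     16 * (a m * s ^ m) \<le> a p * s ^ p \<and> 16 * (a n * s ^ n) \<le> a p * s ^ p)"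

text \<open>For log-concave \<open>a\<close> the set is infinite only if \<open>a (Suc m) = 0\<close>; the value \<open>Suc m\<close> chosen then does not matter
  because all later terms vanish.\<close>

definition next_index :: "(nat \<Rightarrow> real) \<Rightarrow> nat \<Rightarrow> nat" where
  "next_index a m = (let N = {n. m < n \<and> \<not> separated a m n} in if finite N then Max N else Suc m)"

primrec lac_index :: "(nat \<Rightarrow> real) \<Rightarrow> nat \<Rightarrow> nat" where
  "lac_index a 0 = 0"
| "lac_index a (Suc k) = next_index a (lac_index a k)"

lemma next_index: "m < next_index a m" "\<not> separated a m (next_index a m)"
proof -
  let ?N = "{n. m < n \<and> \<not> separated a m n}"
  \<comment> \<open>Nothing lies strictly between \<open>m\<close> and \<open>Suc m\<close>. Hence a
    finite \<open>?N\<close> has a maximum, and the default \<open>Suc m\<close> belongs to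
    \<open>?N\<close> as well.\<close>
  have "Suc m \<in> ?N" by (auto simp: separated_def)
  then have "next_index a m \<in> ?N"
    using Max_in[of ?N] by (auto simp: next_index_def Let_def)
  then show "m < next_index a m" "\<not> separated a m (next_index a m)" by auto
qed

lemma strict_mono_lac_index: "strict_mono (lac_index a)"
  by (simp add: strict_mono_Suc_iff next_index)

text \<open>Passing from \<open>s\<close> to \<open>t = s * u\<close> with \<open>u \<le> 1\<close>
  multiplies the sides by \<open>u ^ n\<close> and \<open>u ^ p\<close>, the higher power being the
  smaller factor. \<open>power_ratio_ge\<close> is the mirror case \<open>u \<ge> 1\<close>.\<close>

lemma power_ratio_le:
  fixes x y s t :: real
  assumes "16 * (x * s ^ n) \<le> y * s ^ p" "p \<le> n" "0 \<le> t" "t \<le> s" "s > 0" "y \<ge> 0"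
  shows "16 * (x * t ^ n) \<le> y * t ^ p"
proof -
  define u where "u = t / s"
  have u: "t = s * u" "0 \<le> u" "u \<le> 1" using assms by (auto simp: u_def)
  have "16 * (x * t ^ n) = 16 * (x * s ^ n) * u ^ n"
    by (simp add: u power_mult_distrib)
  also have "\<dots> \<le> y * s ^ p * u ^ n"
    using assms u by (intro mult_right_mono) auto
  also have "\<dots> \<le> y * s ^ p * u ^ p"
    using assms u by (intro mult_left_mono power_decreasing) auto
  finally show ?thesis by (simp add: u power_mult_distrib)
qed

lemma power_ratio_ge:
  fixes x y s t :: real
  assumes "16 * (x * s ^ m) \<le> y * s ^ p" "m \<le> p" "s \<le> t" "s > 0" "y \<ge> 0"
  shows "16 * (x * t ^ m) \<le> y * t ^ p"
proof -
  define u where "u = t / s"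
  have u: "t = s * u" "1 \<le> u" using assms by (auto simp: u_def)
  have "16 * (x * t ^ m) = 16 * (x * s ^ m) * u ^ m"
    by (simp add: u power_mult_distrib)
  also have "\<dots> \<le> y * s ^ p * u ^ m"
    using assms u by (intro mult_right_mono) auto
  also have "\<dots> \<le> y * s ^ p * u ^ p"
    using assms u by (intro mult_left_mono power_increasing) auto
  finally show ?thesis by (simp add: u power_mult_distrib)
qed

locale log_concave =
  fixes a :: "nat \<Rightarrow> real"
  assumes nonneg: "a n \<ge> 0"
    and zero_pos: "a 0 > 0"
    and pos_SucD: "a (Suc n) > 0 \<Longrightarrow> a n > 0"
    and concave: "a n * a (Suc (Suc n)) \<le> (a (Suc n))\<^sup>2"
    and decay: "(\<lambda>n. a n * t ^ n) \<longlonglongrightarrow> 0"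
begin

lemma pos_mono: "m \<le> n \<Longrightarrow> a n > 0 \<Longrightarrow> a m > 0"
  by (induction rule: inc_induct) (auto intro: pos_SucD)

text \<open>Log-concavity passes to \<open>b k = a k * t ^ k\<close>, so once \<open>b\<close>
  strictly descends it never rises again; \<open>n\<close> is the first descent. A descent exists
  because \<open>b 0 > 0\<close> while \<open>b\<close> tends to 0.\<close>

lemma unimodal:
  assumes t: "t > 0"
  obtains n where "a n > 0"
    "\<And>j k. j \<le> k \<Longrightarrow> k \<le> n \<Longrightarrow> a j * t ^ j \<le> a k * t ^ k"
    "\<And>j k. n \<le> j \<Longrightarrow> j \<le> k \<Longrightarrow> a k * t ^ k \<le> a j * t ^ j"
proof -
  define b where "b k = a k * t ^ k" for k
  have b0: "b k \<ge> 0" for k by (simp add: b_def nonneg t less_imp_le)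
  have "\<exists>n. b (Suc n) < b n"
  proof (rule ccontr)
    assume "\<nexists>n. b (Suc n) < b n"
    then have "incseq b" by (intro incseq_SucI) (simp add: not_less)
    then have "b 0 \<le> 0" using decay[of t] unfolding b_def by (rule incseq_le)
    with zero_pos show False by (simp add: b_def)
  qed
  define n where "n = (LEAST n. b (Suc n) < b n)"
  have n: "b (Suc n) < b n"
    unfolding n_def by (rule LeastI_ex) fact
  have inc: "b k \<le> b (Suc k)" if "k < n" for k
    using not_less_Least[of k "\<lambda>n. b (Suc n) < b n"] that by (auto simp: n_def)
  have dec: "b (Suc k) \<le> b k" if "n \<le> k" for k
    using that
  proof (induction rule: dec_induct)
    case base then show ?case using n by simp
  next
    case (step k)
    show ?case
    proof (cases "a k > 0")
      case True
      have "a k * a (Suc (Suc k)) * (t ^ Suc k)\<^sup>2 \<le> (a (Suc k))\<^sup>2 * (t ^ Suc k)\<^sup>2"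
        by (intro mult_right_mono concave) auto
      then have "b k * b (Suc (Suc k)) \<le> b (Suc k) * b (Suc k)"
        by (simp add: b_def power2_eq_square algebra_simps)
      also have "\<dots> \<le> b k * b (Suc k)"
        by (intro mult_right_mono step b0)
      finally show ?thesis using True t by (simp add: b_def)
    next
      case False
      then have "a (Suc k) = 0" "a (Suc (Suc k)) = 0"
        using pos_mono[of k "Suc k"] pos_mono[of k "Suc (Suc k)"] nonneg
        by (auto simp: less_le)
      then show ?thesis by (simp add: b_def)
    qed
  qed
  show thesis
  proof
    have "0 < b n" using b0 n by (rule le_less_trans)
    then show "a n > 0" using t by (simp add: b_def zero_less_mult_iff)
  next
    fix j k :: nat assume "j \<le> k" "k \<le> n"
    then have "b j \<le> b k"
    proof (induction rule: dec_induct)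
      case (step i)
      then show ?case using inc[of i] by simp
    qed simp
    then show "a j * t ^ j \<le> a k * t ^ k" by (simp add: b_def)
  next
    fix j k assume jk: "n \<le> j" "j \<le> k"
    from jk(2) have "b k \<le> b j"
      by (induction rule: dec_induct) (use jk(1) in \<open>auto intro: order_trans dec\<close>)
    then show "a k * t ^ k \<le> a j * t ^ j" by (simp add: b_def)
  qed
qed

lemma finite_not_separated:
  assumes "a (Suc m) > 0"
  shows "finite {n. m < n \<and> \<not> separated a m n}"
proof -
  have am: "a m > 0" using assms by (rule pos_SucD)
  \<comment> \<open>At this \<open>s\<close> the term of index \<open>Suc m\<close> is exactly 16
    times that of index \<open>m\<close>, so \<open>Suc m\<close> is the separating index for all
    \<open>n\<close> whose term has decayed enough.\<close>
  define s where "s = 16 * a m / a (Suc m)"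
  have s: "s > 0" using am assms by (simp add: s_def)
  have e: "a (Suc m) * s ^ Suc m = 16 * (a m * s ^ m)"
    using assms by (simp add: s_def)
  have "(\<lambda>n. 16 * (a n * s ^ n)) \<longlonglongrightarrow> 16 * 0" by (intro tendsto_intros decay)
  moreover have "16 * 0 < a (Suc m) * s ^ Suc m" using assms s by simp
  ultimately have "\<forall>\<^sub>F n in sequentially. 16 * (a n * s ^ n) < a (Suc m) * s ^ Suc m"
    by (rule order_tendstoD)
  then obtain n0 where n0: "\<And>n. n \<ge> n0 \<Longrightarrow> 16 * (a n * s ^ n) < a (Suc m) * s ^ Suc m"
    by (auto simp: eventually_sequentially)
  have "separated a m n" if "n \<ge> n0" "n > Suc m" for n
    unfolding separated_def using s e n0[OF that(1)] that
    by (intro exI[of _ s] conjI exI[of _ "Suc m"]) auto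
  then have "{n. m < n \<and> \<not> separated a m n} \<subseteq> {..max n0 (Suc m)}"
    by (auto simp: not_less) (meson le_max_iff_disj nat_le_linear not_less)
  then show ?thesis by (rule finite_subset) simp
qed

lemma separated_beyond_next:
  assumes "a (Suc m) > 0" "next_index a m < n"
  shows "separated a m n"
proof (rule ccontr)
  let ?N = "{n. m < n \<and> \<not> separated a m n}"
  assume "\<not> separated a m n"
  then have "n \<in> ?N" using assms next_index(1)[of m a] by simp
  then have "n \<le> Max ?N" using finite_not_separated[OF assms(1)] by simp
  with assms finite_not_separated[OF assms(1)] show False by (simp add: next_index_def)
qed

lemma lacunary:
  assumes t: "t \<ge> 0"
  obtains k0 where "\<And>p. a p * t ^ p \<le> 16 * (a (lac_index a k0) * t ^ lac_index a k0)"
    "\<And>k. a (lac_index a k) * t ^ lac_index a k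
       \<le> 256 * (1/4) ^ ((k - k0) + (k0 - k)) * (a (lac_index a k0) * t ^ lac_index a k0)"
proof (cases "t = 0")
  case True
  have [simp]: "lac_index a k = 0 \<longleftrightarrow> k = 0" for k
    using strict_mono_eq[OF strict_mono_lac_index, of a k 0] by simp
  show thesis
    by (rule that[of 0]) (use True zero_pos in \<open>auto simp: power_0_left\<close>)
next
  case False
  with t have t: "t > 0" by simp
  define \<nu> where "\<nu> = lac_index a"
  define b where "b k = a k * t ^ k" for k
  have b0: "b k \<ge> 0" for k by (simp add: b_def nonneg t less_imp_le)
  have \<nu>: "strict_mono \<nu>" by (simp add: \<nu>_def strict_mono_lac_index)
  obtain n where n: "a n > 0" and inc: "\<And>j k. j \<le> k \<Longrightarrow> k \<le> n \<Longrightarrow> b j \<le> b k"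
    and dec: "\<And>j k. n \<le> j \<Longrightarrow> j \<le> k \<Longrightarrow> b k \<le> b j"
    using unimodal[OF t] unfolding b_def by blast
  have max: "b p \<le> b n" for p
    using inc[of p n] dec[of n p] by linarith
  have sep: "separated a (\<nu> k) (\<nu> (Suc (Suc k)))" if "a (Suc (\<nu> k)) > 0" for k
    using separated_beyond_next[OF that] next_index(1) by (simp add: \<nu>_def)
  \<comment> \<open>Beyond the maximal index two jumps gain a factor 16. If
    \<open>t \<le> s\<close>, the second separation inequality persists at \<open>t\<close>; if
    \<open>s < t\<close>, the first one gives
    \<open>16 * b (\<nu> k) \<le> b p \<le> b (\<nu> k)\<close>, so these terms vanish.\<close>
  have right: "16 * b (\<nu> (Suc (Suc k))) \<le> b (\<nu> k)" if k: "n \<le> \<nu> k" for k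
  proof (cases "a (Suc (\<nu> k)) > 0")
    case True
    then obtain s p where s: "s > 0" "\<nu> k < p" "p < \<nu> (Suc (Suc k))"
      "16 * (a (\<nu> k) * s ^ \<nu> k) \<le> a p * s ^ p"
      "16 * (a (\<nu> (Suc (Suc k))) * s ^ \<nu> (Suc (Suc k))) \<le> a p * s ^ p"
      using sep[OF True] unfolding separated_def by blast
    have p: "b p \<le> b (\<nu> k)" "b (\<nu> (Suc (Suc k))) \<le> b (\<nu> k)"
      using k s by (auto intro: dec)
    show ?thesis
    proof (cases "t \<le> s")
      case True
      then show ?thesis
        using power_ratio_le[OF s(5), of t] s p t nonneg by (auto simp: b_def)
    next
      case False
      then show ?thesis
        using power_ratio_ge[OF s(4), of t] s p b0[of "\<nu> k"] nonneg by (auto simp: b_def)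
    qed
  next
    case False
    then have "b (Suc (\<nu> k)) = 0" using nonneg[of "Suc (\<nu> k)"] by (simp add: b_def)
    moreover have "Suc (\<nu> k) \<le> \<nu> (Suc (Suc k))"
      using \<nu> by (simp add: Suc_le_eq strict_mono_less)
    ultimately have "b (\<nu> (Suc (Suc k))) \<le> 0"
      using dec[of "Suc (\<nu> k)" "\<nu> (Suc (Suc k))"] k by simp
    then show ?thesis using b0[of "\<nu> k"] by simp
  qed
  have left: "16 * b (\<nu> k) \<le> b (\<nu> (Suc (Suc k)))" if k: "\<nu> (Suc (Suc k)) \<le> n" for k
  proof -
    have "Suc (\<nu> k) \<le> \<nu> (Suc (Suc k))"
      using \<nu> by (simp add: Suc_le_eq strict_mono_less)
    then have pos: "a (Suc (\<nu> k)) > 0" using pos_mono[OF _ n, of "Suc (\<nu> k)"] k by simp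
    obtain s p where s: "s > 0" "\<nu> k < p" "p < \<nu> (Suc (Suc k))"
      "16 * (a (\<nu> k) * s ^ \<nu> k) \<le> a p * s ^ p"
      "16 * (a (\<nu> (Suc (Suc k))) * s ^ \<nu> (Suc (Suc k))) \<le> a p * s ^ p"
      using sep[OF pos] unfolding separated_def by blast
    have p: "b p \<le> b (\<nu> (Suc (Suc k)))" "b (\<nu> k) \<le> b (\<nu> (Suc (Suc k)))"
      using k s by (auto intro: inc)
    show ?thesis
    proof (cases "t \<le> s")
      case True
      then show ?thesis
        using power_ratio_le[OF s(5), of t] s p t nonneg b0[of "\<nu> (Suc (Suc k))"]
        by (auto simp: b_def)
    next
      case False
      then show ?thesis
        using power_ratio_ge[OF s(4), of t] s p nonneg by (auto simp: b_def)
    qed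
  qed
  define K where "K = (GREATEST k. \<nu> k \<le> n)"
  have le: "k \<le> n" if "\<nu> k \<le> n" for k
    using strict_mono_imp_increasing[OF \<nu>, of k] that by linarith
  have ex: "\<nu> 0 \<le> n" by (simp add: \<nu>_def)
  have K: "\<nu> K \<le> n"
    unfolding K_def using ex le by (rule GreatestI_nat[where P = "\<lambda>k. \<nu> k \<le> n"])
  have K': "n < \<nu> (Suc K)"
  proof (rule ccontr)
    assume "\<not> n < \<nu> (Suc K)"
    then have "Suc K \<le> K"
      unfolding K_def using le by (intro Greatest_le_nat[where b = n]) (auto simp: K_def)
    then show False by simp
  qed
  \<comment> \<open>The prefactor 4 makes \<open>i = 0\<close> and \<open>i = 1\<close> follow from
    the maximality of \<open>b n\<close>; afterwards each pair of jumps gains 1/16, the square of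
    1/4.\<close>
  have R: "b (\<nu> (Suc K + i)) \<le> 4 * (1/4) ^ i * b n" for i
  proof (induction i rule: induct_nat_012)
    case 0 show ?case using max[of "\<nu> (Suc K)"] b0[of n] by simp
  next
    case 1 show ?case using max[of "\<nu> (Suc (Suc K))"] by simp
  next
    case (ge2 i)
    have "n \<le> \<nu> (Suc K + i)"
      using K' strict_mono_less_eq[OF \<nu>, of "Suc K" "Suc K + i"] by simp
    from right[OF this] ge2 show ?case by simp
  qed
  have L: "i \<le> K \<Longrightarrow> b (\<nu> (K - i)) \<le> 4 * (1/4) ^ i * b n" for i
  proof (induction i rule: induct_nat_012)
    case 0 show ?case using max[of "\<nu> K"] b0[of n] by simp
  next
    case 1 show ?case using max[of "\<nu> (K - 1)"] by simp
  next
    case (ge2 i)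
    have e: "Suc (Suc (K - Suc (Suc i))) = K - i" using ge2.prems by simp
    have "\<nu> (K - i) \<le> n"
      using K strict_mono_less_eq[OF \<nu>, of "K - i" K] by simp
    then show ?case using left[of "K - Suc (Suc i)"] ge2 by (simp add: e)
  qed
  \<comment> \<open>If \<open>n\<close> was skipped, \<open>s = t\<close> and \<open>p = n\<close>
    do not separate \<open>\<nu> K\<close> from \<open>\<nu> (Suc K)\<close>, so one of these two
    terms exceeds \<open>b n / 16\<close>.\<close>
  obtain k0 where k0: "k0 = K \<or> k0 = Suc K" "b n \<le> 16 * b (\<nu> k0)"
  proof (cases "\<nu> K = n")
    case True
    then show thesis using that[of K] b0[of n] by simp
  next
    case False
    then have "\<nu> K < n" using K by simp
    moreover have "\<not> separated a (\<nu> K) (\<nu> (Suc K))"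
      using next_index(2) by (simp add: \<nu>_def)
    ultimately have "\<not> (16 * b (\<nu> K) \<le> b n \<and> 16 * b (\<nu> (Suc K)) \<le> b n)"
      using t K' unfolding separated_def b_def by blast
    then show thesis using that[of K] that[of "Suc K"] by argo
  qed
  \<comment> \<open>Measuring distances from \<open>k0\<close> instead of \<open>K\<close> or
    \<open>Suc K\<close> changes them by at most one, at the cost of a factor 4. Replacing
    \<open>b n\<close> by \<open>16 * b (\<nu> k0)\<close> later completes the constant 256.\<close>
  have far: "b (\<nu> k) \<le> 16 * (1/4) ^ ((k - k0) + (k0 - k)) * b n" for k
  proof (cases "k \<le> K")
    case True
    have "(1/4::real) ^ Suc (K - k) \<le> (1/4) ^ ((k - k0) + (k0 - k))"
      using True k0(1) by (intro power_decreasing) auto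
    then have "4 * (1/4) ^ (K - k) * b n \<le> 16 * (1/4) ^ ((k - k0) + (k0 - k)) * b n"
      by (intro mult_right_mono b0) auto
    moreover have "b (\<nu> k) \<le> 4 * (1/4) ^ (K - k) * b n" using L[of "K - k"] True by simp
    ultimately show ?thesis by (rule order_trans[rotated])
  next
    case False
    then have e: "k = Suc K + (k - Suc K)" by simp
    have "(1/4::real) ^ Suc (k - Suc K) \<le> (1/4) ^ ((k - k0) + (k0 - k))"
      using False k0(1) by (intro power_decreasing) auto
    then have "4 * (1/4) ^ (k - Suc K) * b n \<le> 16 * (1/4) ^ ((k - k0) + (k0 - k)) * b n"
      by (intro mult_right_mono b0) auto
    moreover have "b (\<nu> k) \<le> 4 * (1/4) ^ (k - Suc K) * b n"
      using R[of "k - Suc K"] e by metis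
    ultimately show ?thesis by (rule order_trans[rotated])
  qed
  show thesis
  proof (rule that[of k0])
    fix p show "a p * t ^ p \<le> 16 * (a (lac_index a k0) * t ^ lac_index a k0)"
      using max[of p] k0(2) by (simp add: b_def \<nu>_def)
  next
    fix k
    have "16 * (1/4) ^ ((k - k0) + (k0 - k)) * b n
        \<le> 16 * (1/4) ^ ((k - k0) + (k0 - k)) * (16 * b (\<nu> k0))"
      by (intro mult_left_mono k0) auto
    from order_trans[OF far[of k] this]
    have "b (\<nu> k) \<le> 256 * (1/4) ^ ((k - k0) + (k0 - k)) * b (\<nu> k0)"
      by (simp add: mult_ac)
    then show "a (lac_index a k) * t ^ lac_index a k
       \<le> 256 * (1/4) ^ ((k - k0) + (k0 - k)) * (a (lac_index a k0) * t ^ lac_index a k0)"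
      by (simp only: b_def \<nu>_def)
  qed
qed

end

text \<open>Splitting a lacunary series into residue classes modulo \<open>M\<close> isolates the dominant index
  \<open>k0\<close> from all other indices of its class.\<close>

lemma residue_class_sums:
  fixes P :: "nat \<Rightarrow> nat \<Rightarrow> complex"
  assumes B: "\<And>k. B k \<le> 256 * (1/4) ^ ((k - k0) + (k0 - k)) * B k0"
    and P: "\<And>k j. j < J \<Longrightarrow> cmod (P k j) \<le> B k"
    and \<delta>: "\<delta> * B k0 \<le> (\<Sum>j<J. cmod (P k0 j))"
    and M: "M > 0" "real J * (768 * (1/2) ^ M) \<le> \<delta> / 2"
    and B0: "B k0 \<ge> 0"
  defines "F \<equiv> \<lambda>i. \<Sum>k. if k mod M = i mod M then P k (i div M) else 0"
  shows "i < J * M \<Longrightarrow> cmod (F i) \<le> 768 * B k0"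
    and "\<delta> / 2 * B k0 \<le> (\<Sum>i<J * M. cmod (F i))"
proof -
  let ?d = "\<lambda>k. (k - k0) + (k0 - k)"
  let ?u = "\<lambda>i k. if k mod M = i mod M then P k (i div M) else 0"
  \<comment> \<open>One factor \<open>(1/2) ^ d\<close> is kept for the summation over
    \<open>k\<close>, the other yields the gain \<open>(1/2) ^ M\<close> away from
    \<open>k0\<close>.\<close>
  have quarter: "(1/4::real) ^ d = (1/2) ^ d * (1/2) ^ d" for d
    by (simp flip: power_mult_distrib)
  have P': "cmod (P k j) \<le> 256 * B k0 * ((1/2) ^ ?d k * (1/2) ^ ?d k)" if "j < J" for k j
    using order_trans[OF P[OF that] B[of k]] by (simp only: quarter mult_ac)
  have u: "cmod (?u i k) \<le> 256 * B k0 * (1/2) ^ ?d k" if i: "i < J * M" for i k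
  proof -
    have "256 * B k0 * ((1/2) ^ ?d k * (1/2) ^ ?d k) \<le> 256 * B k0 * (1 * (1/2) ^ ?d k)"
      using B0 by (intro mult_left_mono mult_right_mono power_le_one) auto
    then show ?thesis
      using P'[of "i div M" k] i B0 by (auto simp: less_mult_imp_div_less)
  qed
  show bound: "cmod (F i) \<le> 768 * B k0" if "i < J * M" for i
    using sums_half_power_dist_bound(2)[OF u[OF that]] B0 by (simp add: F_def)
  define r where "r = k0 mod M"
  have r: "r < M" using M by (simp add: r_def)
  have isolate: "cmod (P k0 j) - 768 * (1/2) ^ M * B k0 \<le> cmod (F (j * M + r))" if j: "j < J" for j
  proof -
    \<comment> \<open>The index codes the member \<open>j\<close> together with the residue class of
      \<open>k0\<close>; every other \<open>k\<close> in this class is at distance at least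
      \<open>M\<close> from \<open>k0\<close>.\<close>
    define i where "i = j * M + r"
    have i: "i div M = j" "i mod M = r" using r by (auto simp: i_def)
    have iJ: "i < J * M"
    proof -
      have "i < Suc j * M" using r by (simp add: i_def)
      also have "\<dots> \<le> J * M" using j by (intro mult_le_mono1) simp
      finally show ?thesis .
    qed
    have s: "summable (?u i)"
      using sums_half_power_dist_bound(1)[OF u[OF iJ]] B0 by simp
    let ?v = "\<lambda>k. if k = k0 then P k0 j else 0"
    have v: "?v sums P k0 j"
      using sums_single[of k0 "\<lambda>_. P k0 j"] by simp
    have "cmod (?u i k - ?v k) \<le> (256 * (1/2) ^ M * B k0) * (1/2) ^ ?d k" for k
    proof (cases "k mod M = r \<and> k \<noteq> k0")
      case True
      have "M \<le> ?d k"
      proof (cases "k \<le> k0")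
        case le: True
        have "M dvd k0 - k" using True le by (metis mod_eq_dvd_iff_nat r_def)
        then show ?thesis using True le by (auto dest!: dvd_imp_le)
      next
        case False
        have "M dvd k - k0" using True False by (metis mod_eq_dvd_iff_nat nat_le_linear r_def)
        then show ?thesis using False by (auto dest!: dvd_imp_le)
      qed
      then have "(1/2::real) ^ ?d k \<le> (1/2) ^ M" by (intro power_decreasing) auto
      then have "256 * B k0 * ((1/2) ^ ?d k * (1/2) ^ ?d k) \<le> 256 * B k0 * ((1/2) ^ M * (1/2) ^ ?d k)"
        using B0 by (intro mult_left_mono mult_right_mono) auto
      then show ?thesis
        using True i P'[OF j, of k] by (simp add: mult_ac)
    next
      case False
      then show ?thesis using i B0 by (auto simp: r_def)
    qed
    then have "cmod (\<Sum>k. ?u i k - ?v k) \<le> 3 * (256 * (1/2) ^ M * B k0)"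
      by (rule sums_half_power_dist_bound(2)) (use B0 in simp)
    also have "(\<Sum>k. ?u i k - ?v k) = F i - P k0 j"
      using sums_diff[OF summable_sums[OF s] v] by (simp add: sums_iff F_def)
    finally show ?thesis
      using norm_triangle_ineq2[of "P k0 j" "F i"] by (simp add: i_def norm_minus_commute)
  qed
  \<comment> \<open>\<open>M\<close> is so large that the errors of all \<open>J\<close> members
    together cost at most half of \<open>\<delta>\<close>.\<close>
  have "\<delta> / 2 * B k0 \<le> \<delta> * B k0 - real J * (768 * (1/2) ^ M) * B k0"
    using mult_right_mono[OF M(2) B0] by (simp add: algebra_simps)
  also have "\<dots> \<le> (\<Sum>j<J. cmod (P k0 j) - 768 * (1/2) ^ M * B k0)"
    using \<delta> by (simp add: sum_subtractf)
  also have "\<dots> \<le> (\<Sum>j<J. cmod (F (j * M + r)))"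
    by (intro sum_mono isolate) auto
  also have "\<dots> = (\<Sum>i\<in>(\<lambda>j. j * M + r) ` {..<J}. cmod (F i))"
    using M by (subst sum.reindex) (auto simp: inj_on_def)
  also have "\<dots> \<le> (\<Sum>i<J * M. cmod (F i))"
  proof (intro sum_mono2 subsetI)
    fix i assume "i \<in> (\<lambda>j. j * M + r) ` {..<J}"
    then obtain j where j: "j < J" "i = j * M + r" by auto
    have "i < Suc j * M" using r j by simp
    also have "\<dots> \<le> J * M" using j by (intro mult_le_mono1) simp
    finally show "i \<in> {..<J * M}" by simp
  qed auto
  finally show "\<delta> / 2 * B k0 \<le> (\<Sum>i<J * M. cmod (F i))" .
qed

text \<open>Residues are taken of the position \<open>k\<close>, not of the exponent
  \<open>lac_index a k\<close>, because the decay in \<open>lacunary\<close> is in the distance of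
  positions. The indices \<open>i < J * M\<close> code pairs of a member and a residue.\<close>

definition lac_sum ::
  "(nat \<Rightarrow> real) \<Rightarrow> (nat \<Rightarrow> nat \<Rightarrow> complex ^ 'n \<Rightarrow> complex) \<Rightarrow> nat \<Rightarrow> nat \<Rightarrow> complex ^ 'n \<Rightarrow> complex" where
  "lac_sum a T M i z = (\<Sum>k. if k mod M = i mod M
     then complex_of_real (a (lac_index a k)) * T (lac_index a k) (i div M) z else 0)"

section \<open>Lacunary series of entire functions\<close>

context log_concave
begin

lemma entire_lac_sum:
  assumes T: "\<And>n. entire (T n (i div M))"
    and R: "\<And>R. R \<ge> 0 \<Longrightarrow> \<exists>s\<ge>0. \<exists>t\<ge>0. \<forall>n z. norm z \<le> R \<longrightarrow>
      a n * cmod (T n (i div M) z) \<le> s * (a n * t ^ n)"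
  shows "entire (lac_sum a T M i)"
proof -
  obtain s t where st: "\<And>R. R \<ge> 0 \<Longrightarrow> s R \<ge> 0 \<and> t R \<ge> 0 \<and> (\<forall>n z. norm z \<le> R \<longrightarrow>
      a n * cmod (T n (i div M) z) \<le> s R * (a n * t R ^ n))"
    using R by metis
  let ?B = "\<lambda>k R. s R * (a (lac_index a k) * t R ^ lac_index a k)"
  have "entire (\<lambda>z. \<Sum>k. if k mod M = i mod M
     then complex_of_real (a (lac_index a k)) * T (lac_index a k) (i div M) z else 0)"
  proof (rule entire_suminf[where B = ?B])
    fix k
    show "entire (\<lambda>z. if k mod M = i mod M
       then complex_of_real (a (lac_index a k)) * T (lac_index a k) (i div M) z else 0)"
      by (cases "k mod M = i mod M") (simp_all add: entire_const entire_mult T)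
  next
    fix k R and z :: "complex ^ 'a" assume z: "norm z \<le> R"
    then have "R \<ge> 0" using norm_ge_zero order_trans by blast
    then show "cmod (if k mod M = i mod M
       then complex_of_real (a (lac_index a k)) * T (lac_index a k) (i div M) z else 0) \<le> ?B k R"
      using st[of R] z nonneg by (auto simp: norm_mult)
  next
    fix R :: real assume "R \<ge> 0"
    then have t: "t R \<ge> 0" using st by simp
    let ?b = "\<lambda>k. a (lac_index a k) * t R ^ lac_index a k"
    obtain k0 where k0: "\<And>k. ?b k \<le> 256 * (1/4) ^ ((k - k0) + (k0 - k)) * ?b k0"
      by (rule lacunary[OF t]) (rule that)
    have "summable ?b"
    proof (rule summable_comparison_test')
      show "summable (\<lambda>k. 256 * (1/2) ^ ((k - k0) + (k0 - k)) * ?b k0)"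
        by (rule summable_mult2[OF summable_mult[OF sums_summable[OF sums_half_power_dist]]])
      fix k :: nat
      have "(1/4::real) ^ ((k - k0) + (k0 - k)) \<le> (1/2) ^ ((k - k0) + (k0 - k))"
        by (intro power_mono) auto
      then have "256 * (1/4) ^ ((k - k0) + (k0 - k)) * ?b k0
          \<le> 256 * (1/2) ^ ((k - k0) + (k0 - k)) * ?b k0"
        using nonneg t by (intro mult_right_mono mult_left_mono) auto
      moreover have "norm (?b k) = ?b k" using nonneg t by simp
      ultimately show "norm (?b k) \<le> 256 * (1/2) ^ ((k - k0) + (k0 - k)) * ?b k0"
        using k0[of k] by linarith
    qed
    then show "summable (\<lambda>k. ?B k R)" by (rule summable_mult)
  qed
  then show ?thesis unfolding lac_sum_def[abs_def] .
qed

text \<open>\<open>residue_class_sums\<close> at a fixed point \<open>z\<close>, with the dominant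
  index supplied by \<open>lacunary\<close>. The factor \<open>a n\<close> in the hypotheses makes
  them trivial where the coefficient vanishes.\<close>

lemma lac_sum_bounds:
  assumes st: "s \<ge> 0" "t \<ge> 0"
    and upper: "\<And>n j. j < J \<Longrightarrow> a n * cmod (T n j z) \<le> s * (a n * t ^ n)"
    and lower: "\<And>n. \<delta> * (s * (a n * t ^ n)) \<le> (\<Sum>j<J. a n * cmod (T n j z))"
    and M: "M > 0" "real J * (768 * (1/2) ^ M) \<le> \<delta> / 2"
  obtains m where "\<And>p. a p * t ^ p \<le> 16 * (a m * t ^ m)"
    "\<And>i. i < J * M \<Longrightarrow> cmod (lac_sum a T M i z) \<le> 768 * (s * (a m * t ^ m))"
    "\<delta> / 2 * (s * (a m * t ^ m)) \<le> (\<Sum>i<J * M. cmod (lac_sum a T M i z))"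
proof -
  let ?b = "\<lambda>k. a (lac_index a k) * t ^ lac_index a k"
  obtain k0 where k0: "\<And>p. a p * t ^ p \<le> 16 * ?b k0"
      "\<And>k. ?b k \<le> 256 * (1/4) ^ ((k - k0) + (k0 - k)) * ?b k0"
    using lacunary[OF st(2)] by blast
  let ?P = "\<lambda>k j. complex_of_real (a (lac_index a k)) * T (lac_index a k) j z"
  have B: "s * ?b k \<le> 256 * (1/4) ^ ((k - k0) + (k0 - k)) * (s * ?b k0)" for k
    using mult_left_mono[OF k0(2) st(1)] by (simp add: mult_ac)
  have P: "cmod (?P k j) \<le> s * ?b k" if "j < J" for k j
    using upper[OF that] nonneg by (simp add: norm_mult)
  have \<delta>: "\<delta> * (s * ?b k0) \<le> (\<Sum>j<J. cmod (?P k0 j))"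
    using lower nonneg by (simp add: norm_mult)
  have B0: "s * ?b k0 \<ge> 0" using st nonneg by simp
  note * = residue_class_sums[of "\<lambda>k. s * ?b k" k0 J ?P \<delta> M, OF B P \<delta> M B0]
  show thesis
    by (rule that[OF k0(1)]) (use * in \<open>auto simp: lac_sum_def\<close>)
qed

end

section \<open>Families of polynomials bounded below on the sphere\<close>

lemma power_le_exp:
  fixes u :: real
  assumes "u \<ge> 0"
  shows "u ^ k \<le> real k ^ k * exp (u - real k)"
proof (cases "k = 0")
  case True
  then show ?thesis using assms by simp
next
  case False
  have "(1 + (u - real k) / real k) ^ k \<le> exp (u - real k)"
    using assms False by (intro exp_ge_one_plus_x_over_n_power_n) auto
  also have "1 + (u - real k) / real k = u / real k" using False by (simp add: field_simps)
  finally show ?thesis using False by (simp add: power_divide field_simps)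
qed

text \<open>By Bernoulli \<open>(1 - u / m) ^ m\<close> is at least 1/2, so lowering the base by a
  rounding error costs a factor 2.\<close>

lemma self_power_le:
  fixes u :: real
  assumes "0 \<le> u" "u \<le> 1/2"
  shows "real m ^ m \<le> 2 * (real m - u) ^ m"
proof (cases "m = 0")
  case False
  have "1 + real m * (- (u / real m)) \<le> (1 + - (u / real m)) ^ m"
    using assms False by (intro Bernoulli_inequality) (auto simp: field_simps)
  then have "1 \<le> 2 * (1 - u / real m) ^ m" using assms False by simp
  then have "real m ^ m * 1 \<le> real m ^ m * (2 * (1 - u / real m) ^ m)"
    by (intro mult_left_mono) auto
  also have "\<dots> = 2 * (real m * (1 - u / real m)) ^ m" by (simp add: power_mult_distrib)
  also have "real m * (1 - u / real m) = real m - u" using False by (simp add: field_simps)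
  finally show ?thesis by simp
qed simp

text \<open>\<open>entropy_coeff N k\<close> is the infimum of \<open>(1 + x) ^ N / x ^ k\<close> over \<open>x > 0\<close>, attained at
  \<open>x = k / (N - k)\<close>; recall \<open>0 ^ 0 = 1\<close>.\<close>

definition entropy_coeff :: "nat \<Rightarrow> nat \<Rightarrow> real" where
  "entropy_coeff N k = (if k \<le> N then real N ^ N / (real k ^ k * real (N - k) ^ (N - k)) else 0)"

lemma entropy_coeff_denom_pos: "real k ^ k * real m ^ m > 0"
  by (cases "k = 0"; cases "m = 0") auto

lemma entropy_coeff_pos: "k \<le> N \<Longrightarrow> entropy_coeff N k > 0"
  using entropy_coeff_denom_pos[of k "N - k"] entropy_coeff_denom_pos[of N 0]
  by (simp add: entropy_coeff_def)

text \<open>After scaling to \<open>p + q = 1\<close>, \<open>power_le_exp\<close> is applied at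
  \<open>N * p\<close> and \<open>N * q\<close>; the two exponentials cancel because
  \<open>k + (N - k) = N\<close>.\<close>

lemma entropy_coeff_le:
  assumes "x \<ge> 0" "y \<ge> 0" "k \<le> N"
  shows "entropy_coeff N k * x ^ k * y ^ (N - k) \<le> (x + y) ^ N"
proof (cases "x + y = 0")
  case True
  then have "x = 0" "y = 0" using assms by auto
  then show ?thesis using assms
    by (cases "N = 0"; cases "k = 0") (auto simp: entropy_coeff_def power_0_left)
next
  case False
  define p q where "p = x / (x + y)" and "q = y / (x + y)"
  have "p + q = (x + y) / (x + y)" by (simp only: p_def q_def add_divide_distrib)
  then have pq: "p \<ge> 0" "q \<ge> 0" "p + q = 1"
    using assms False by (auto simp: p_def q_def)
  have xy: "p * (x + y) = x" "q * (x + y) = y" using False by (auto simp: p_def q_def)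
  let ?D = "real k ^ k * real (N - k) ^ (N - k)"
  have "real N ^ N * (p ^ k * q ^ (N - k)) = (real N * p) ^ k * (real N * q) ^ (N - k)"
    using assms by (simp add: power_mult_distrib flip: power_add)
  also have "\<dots> \<le> (real k ^ k * exp (real N * p - real k)) *
      (real (N - k) ^ (N - k) * exp (real N * q - real (N - k)))"
    using pq by (intro mult_mono power_le_exp) auto
  also have "\<dots> = ?D * exp (real N * (p + q) - real N)"
    using assms by (simp add: exp_add[symmetric] algebra_simps of_nat_diff flip: exp_add)
  also have "\<dots> = ?D" using pq by simp
  finally have "entropy_coeff N k * (p ^ k * q ^ (N - k)) \<le> 1"
    using assms entropy_coeff_denom_pos[of k "N - k"] by (simp add: entropy_coeff_def)
  then have "entropy_coeff N k * (p ^ k * q ^ (N - k)) * (x + y) ^ N \<le> 1 * (x + y) ^ N"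
    using assms by (intro mult_right_mono) auto
  also have "entropy_coeff N k * (p ^ k * q ^ (N - k)) * (x + y) ^ N
      = entropy_coeff N k * (p * (x + y)) ^ k * (q * (x + y)) ^ (N - k)"
    using assms by (simp add: power_mult_distrib mult_ac flip: power_add)
  finally show ?thesis unfolding xy by simp
qed

lemma entropy_coeff_ge:
  assumes "x \<ge> 0" "y \<ge> 0"
  shows "\<exists>k\<le>N. (x + y) ^ N \<le> 2 * (entropy_coeff N k * x ^ k * y ^ (N - k))"
proof (cases "x + y = 0")
  case True
  then have "x = 0" "y = 0" using assms by auto
  then show ?thesis
    by (intro exI[of _ 0]) (auto simp: entropy_coeff_def power_0_left)
next
  case False
  define p q where "p = x / (x + y)" and "q = y / (x + y)"
  have "p + q = (x + y) / (x + y)" by (simp only: p_def q_def add_divide_distrib)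
  then have pq: "p \<ge> 0" "q \<ge> 0" "p + q = 1"
    using assms False by (auto simp: p_def q_def)
  have xy: "p * (x + y) = x" "q * (x + y) = y" using False by (auto simp: p_def q_def)
  \<comment> \<open>For real \<open>k\<close> the maximum of the terms would sit at
    \<open>N * p\<close>; the nearest integer is taken.\<close>
  define k where "k = nat (round (real N * p))"
  have "real N * p \<le> real N * 1" using pq by (intro mult_left_mono) auto
  then have "round (real N * p) \<le> int N" using round_mono[of "real N * p" "real N"] by simp
  moreover have "0 \<le> round (real N * p)" using pq round_mono[of 0 "real N * p"] by simp
  ultimately have k: "k \<le> N" "real k = of_int (round (real N * p))" by (auto simp: k_def)
  define m u where "m = N - k" and "u = real N * p"
  have near: "\<bar>real k - u\<bar> \<le> 1/2" unfolding k(2) u_def by (rule of_int_round_abs_le)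
  have u: "u \<ge> 0" using pq by (simp add: u_def)
  have "q = 1 - p" using pq by simp
  then have v: "real N * q = real m - (u - real k)"
    using k(1) by (simp only: m_def of_nat_diff u_def) (simp add: algebra_simps)
  let ?D = "real k ^ k * real m ^ m"
  \<comment> \<open>The rounding errors of \<open>k\<close> and \<open>m\<close> are opposite, so
    only one of the two powers loses the factor 2.\<close>
  have "?D \<le> 2 * (u ^ k * (real m - (u - real k)) ^ m)"
  proof (cases "real k \<le> u")
    case True
    have "real m ^ m \<le> 2 * (real m - (u - real k)) ^ m"
      by (rule self_power_le) (use True near in linarith)+
    moreover have "real k ^ k \<le> u ^ k" by (rule power_mono[OF True]) simp
    ultimately have "?D \<le> u ^ k * (2 * (real m - (u - real k)) ^ m)"
      using u by (intro mult_mono) auto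
    then show ?thesis by (simp only: mult_ac)
  next
    case False
    have "real k ^ k \<le> 2 * (real k - (real k - u)) ^ k"
      by (rule self_power_le) (use False near in linarith)+
    then have "real k ^ k \<le> 2 * u ^ k" by simp
    moreover have "real m ^ m \<le> (real m - (u - real k)) ^ m"
      using False by (intro power_mono) linarith+
    ultimately have "?D \<le> (2 * u ^ k) * (real m - (u - real k)) ^ m"
      using u by (intro mult_mono) auto
    then show ?thesis by (simp only: mult_ac)
  qed
  then have "?D \<le> 2 * ((real N * p) ^ k * (real N * q) ^ m)"
    by (simp only: v u_def[symmetric])
  also have "\<dots> = 2 * (real N ^ N * (p ^ k * q ^ m))"
    using k(1) by (simp add: power_mult_distrib m_def flip: power_add)
  finally have "1 \<le> 2 * (entropy_coeff N k * (p ^ k * q ^ m))"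
    using k(1) entropy_coeff_denom_pos[of k m] by (simp add: entropy_coeff_def m_def)
  then have "1 * (x + y) ^ N \<le> 2 * (entropy_coeff N k * (p ^ k * q ^ m)) * (x + y) ^ N"
    using assms by (intro mult_right_mono) auto
  also have "\<dots> = 2 * (entropy_coeff N k * (p * (x + y)) ^ k * (q * (x + y)) ^ m)"
    using k(1) by (simp add: power_mult_distrib mult_ac m_def flip: power_add)
  finally show ?thesis using k(1) unfolding xy m_def by auto
qed

text \<open>At \<open>x = Suc k\<close>, \<open>y = N - Suc k\<close> the bound
  \<open>entropy_coeff_le\<close> is an equality for the middle index. Multiplying the bounds for
  its two neighbours there, the monomials cancel.\<close>

lemma log_concave_sqrt_entropy_coeff: "log_concave (\<lambda>k. sqrt (entropy_coeff N k))"
proof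
  fix k
  show "sqrt (entropy_coeff N k) \<ge> 0"
    using entropy_coeff_pos[of k N] by (cases "k \<le> N") (auto simp: entropy_coeff_def)
  show "sqrt (entropy_coeff N 0) > 0" using entropy_coeff_pos[of 0 N] by simp
  show "sqrt (entropy_coeff N k) > 0" if "sqrt (entropy_coeff N (Suc k)) > 0"
    using that entropy_coeff_pos[of k N] by (cases "Suc k \<le> N") (auto simp: entropy_coeff_def)
  have "entropy_coeff N k * entropy_coeff N (Suc (Suc k)) \<le> (entropy_coeff N (Suc k))\<^sup>2"
  proof (cases "Suc (Suc k) \<le> N")
    case True
    define x y where "x = real (Suc k)" and "y = real (N - Suc k)"
    have xy: "x > 0" "y > 0" using True by (auto simp: x_def y_def)
    have "x + y = real N" using True by (simp add: x_def y_def of_nat_diff)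
    then have e: "entropy_coeff N (Suc k) * x ^ Suc k * y ^ (N - Suc k) = (x + y) ^ N"
      using True entropy_coeff_denom_pos[of "Suc k" "N - Suc k"]
      by (simp add: entropy_coeff_def x_def y_def del: power_Suc of_nat_Suc)
    let ?w = "x ^ Suc k * y ^ (N - Suc k)"
    have "entropy_coeff N k * x ^ k * y ^ (N - k) *
        (entropy_coeff N (Suc (Suc k)) * x ^ Suc (Suc k) * y ^ (N - Suc (Suc k)))
      \<le> (x + y) ^ N * (x + y) ^ N"
      using True xy entropy_coeff_pos[of k N] entropy_coeff_pos[of "Suc (Suc k)" N]
      by (intro mult_mono entropy_coeff_le) auto
    also have "\<dots> = (entropy_coeff N (Suc k))\<^sup>2 * ?w\<^sup>2"
      unfolding e[symmetric] by (simp add: power2_eq_square mult_ac)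
    also have "entropy_coeff N k * x ^ k * y ^ (N - k) *
        (entropy_coeff N (Suc (Suc k)) * x ^ Suc (Suc k) * y ^ (N - Suc (Suc k)))
      = (entropy_coeff N k * entropy_coeff N (Suc (Suc k))) * ?w\<^sup>2"
    proof -
      have "N - k = Suc (Suc (N - Suc (Suc k)))" "N - Suc k = Suc (N - Suc (Suc k))"
        using True by auto
      then show ?thesis by (simp add: power2_eq_square mult_ac)
    qed
    finally show ?thesis using xy by (subst (asm) mult_le_cancel_right_pos) auto
  qed (simp add: entropy_coeff_def)
  then have "sqrt (entropy_coeff N k * entropy_coeff N (Suc (Suc k))) \<le> sqrt ((entropy_coeff N (Suc k))\<^sup>2)"
    by (rule real_sqrt_le_mono)
  moreover have "entropy_coeff N (Suc k) \<ge> 0"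
    using entropy_coeff_pos[of "Suc k" N] by (cases "Suc k \<le> N") (auto simp: entropy_coeff_def)
  ultimately show "sqrt (entropy_coeff N k) * sqrt (entropy_coeff N (Suc (Suc k)))
      \<le> (sqrt (entropy_coeff N (Suc k)))\<^sup>2"
    by (simp add: real_sqrt_mult)
next
  fix t :: real
  show "(\<lambda>k. sqrt (entropy_coeff N k) * t ^ k) \<longlonglongrightarrow> 0"
    by (rule tendsto_eventually)
      (auto simp: eventually_sequentially entropy_coeff_def intro!: exI[of _ "Suc N"])
qed

text \<open>Defined on the whole space, so that coordinates can be added one at a time within a
  single type.\<close>

definition subnorm :: "'n set \<Rightarrow> complex ^ 'n \<Rightarrow> real" where
  "subnorm S z = L2_set (\<lambda>i. cmod (z $ i)) S"

lemma subnorm_nonneg: "subnorm S z \<ge> 0"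
  by (simp add: subnorm_def)

lemma subnorm_UNIV: "subnorm UNIV z = norm z"
  by (simp add: subnorm_def norm_vec_def)

lemma subnorm_le_norm: "subnorm S (z :: complex ^ 'n) \<le> norm z"
  unfolding subnorm_UNIV[symmetric] subnorm_def L2_set_def
  by (intro real_sqrt_le_mono sum_mono2) auto

lemma subnorm_insert:
  "i \<notin> S \<Longrightarrow> (subnorm (insert i S) (z :: complex ^ 'n))\<^sup>2 = (subnorm S z)\<^sup>2 + (cmod (z $ i))\<^sup>2"
  by (simp add: subnorm_def sum_nonneg)

lemma continuous_on_subnorm: "continuous_on A (subnorm S)"
  unfolding subnorm_def[abs_def] L2_set_def
  by (intro continuous_intros)

text \<open>The complement of the hyperplane \<open>z $ i = 0\<close> is dense. This permits
  division by \<open>cmod (z $ i)\<close> in the construction below.\<close>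

lemma le_of_nonzero_component:
  fixes f g :: "complex ^ 'n \<Rightarrow> real"
  assumes f: "continuous_on UNIV f" and g: "continuous_on UNIV g"
    and le: "\<And>z. z $ i \<noteq> 0 \<Longrightarrow> f z \<le> g z"
  shows "f z \<le> g z"
proof (cases "z $ i = 0")
  case True
  define x where "x m = z + axis i (complex_of_real (1 / real (Suc m)))" for m
  have "(\<lambda>m. z + axis i (complex_of_real (1 / real (Suc m)))) \<longlonglongrightarrow> z + axis i (complex_of_real 0)"
  proof (intro tendsto_add tendsto_const)
    have "(\<lambda>m. complex_of_real (1 / real (Suc m))) \<longlonglongrightarrow> complex_of_real 0"
      using LIMSEQ_inverse_real_of_nat by (intro tendsto_of_real) (simp add: inverse_eq_divide)
    then have "(\<lambda>m. axis i (complex_of_real (1 / real (Suc m))) $ j) \<longlonglongrightarrow> axis i (complex_of_real 0) $ j" for j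
      by (cases "j = i") (simp_all add: axis_def)
    then show "(\<lambda>m. axis i (complex_of_real (1 / real (Suc m)))) \<longlonglongrightarrow> axis i (complex_of_real 0)"
      by (rule vec_tendstoI)
  qed
  then have x: "x \<longlonglongrightarrow> z"
    by (simp add: x_def[abs_def] axis_def vec_eq_iff zero_vec_def[symmetric])
  have "f (x m) \<le> g (x m)" for m
    by (rule le) (simp add: x_def True del: of_nat_Suc)
  moreover have "(\<lambda>m. f (x m)) \<longlonglongrightarrow> f z" "(\<lambda>m. g (x m)) \<longlonglongrightarrow> g z"
    using continuous_on_tendsto_compose[OF f x] continuous_on_tendsto_compose[OF g x] by auto
  ultimately show ?thesis by (intro LIMSEQ_le) auto
qed (rule le)

lemma exists_modulus:
  assumes "\<delta> > 0"
  shows "\<exists>M>0. real J * (768 * (1/2) ^ M) \<le> \<delta> / 2"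
proof -
  have "(\<lambda>M. real J * (768 * (1/2) ^ M)) \<longlonglongrightarrow> real J * (768 * 0)"
    by (intro tendsto_intros LIMSEQ_realpow_zero) auto
  then have "\<forall>\<^sub>F M in sequentially. real J * (768 * (1/2) ^ M) < \<delta> / 2"
    using assms by (intro order_tendstoD) auto
  then obtain M0 where "\<And>M. M \<ge> M0 \<Longrightarrow> real J * (768 * (1/2) ^ M) < \<delta> / 2"
    by (auto simp: eventually_sequentially)
  from this[of "Suc M0"] show ?thesis by (intro exI[of _ "Suc M0"]) simp
qed

text \<open>A substitute for the Ryll--Wojtaszczyk polynomials. The coordinate \<open>z $ i\<close> is added by
  decomposing \<open>(r\<^sup>2 + w\<^sup>2) ^ (N / 2)\<close> into the monomials \<open>r ^ k * w ^ (N - k)\<close> with square root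
  entropy coefficients, which behaves like a one-variable radial weight in \<open>r / w\<close>.\<close>

lemma bounded_below_family:
  fixes S :: "'n::finite set"
  assumes "finite S"
  shows "\<exists>(J::nat) \<delta> p. \<delta> > 0 \<and>
    (\<forall>n. \<forall>j<J. entire (p n j) \<and> (\<forall>z :: complex ^ 'n. cmod (p n j z) \<le> subnorm S z ^ n)) \<and>
    (\<forall>n z. \<delta> * subnorm S z ^ n \<le> (\<Sum>j<J. cmod (p n j z)))"
  using assms
proof induction
  case empty
  \<comment> \<open>The norm over no coordinates is 0, so a single constant \<open>0 ^ n\<close>
    suffices; it is 1 in degree 0.\<close>
  show ?case
    by (intro exI[of _ "1::nat"] exI[of _ "1::real"] exI[of _ "\<lambda>(n::nat) (j::nat) (z::complex ^ 'n). 0 ^ n"])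
      (auto simp: subnorm_def entire_const norm_power)
next
  case (insert i S)
  from insert.IH obtain J \<delta> and p :: "nat \<Rightarrow> nat \<Rightarrow> complex ^ 'n \<Rightarrow> complex"
    where IH: "\<delta> > 0 \<and>
      (\<forall>n. \<forall>j<J. entire (p n j) \<and> (\<forall>z. cmod (p n j z) \<le> subnorm S z ^ n)) \<and>
      (\<forall>n z. \<delta> * subnorm S z ^ n \<le> (\<Sum>j<J. cmod (p n j z)))"
    by (elim exE)
  then have \<delta>: "\<delta> > 0"
    and p: "\<And>n j. j < J \<Longrightarrow> entire (p n j)"
      "\<And>n j z. j < J \<Longrightarrow> cmod (p n j z) \<le> subnorm S z ^ n"
    and low: "\<And>n z. \<delta> * subnorm S z ^ n \<le> (\<Sum>j<J. cmod (p n j z))"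
    by simp_all
  obtain M where M: "M > 0" "real J * (768 * (1/2) ^ M) \<le> \<delta> / 2"
    using exists_modulus[OF \<delta>] by blast
  define a where "a N k = sqrt (entropy_coeff N k)" for N k
  \<comment> \<open>Powers of the new coordinate fill the degree up to \<open>N\<close>. Truncation
    in \<open>N - n\<close> is harmless because \<open>a N n = 0\<close> for
    \<open>n > N\<close>.\<close>
  define T where "T N n j z = p n j z * (z $ i) ^ (N - n)" for N n j z
  define f where "f N l = lac_sum (a N) (T N) M l" for N l
  interpret log_concave "a N" for N
    unfolding a_def[abs_def] by (rule log_concave_sqrt_entropy_coeff)
  let ?r = "subnorm S" and ?R = "subnorm (insert i S)"
  have R: "(?R z)\<^sup>2 = (?r z)\<^sup>2 + (cmod (z $ i))\<^sup>2" for z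
    using insert by (simp add: subnorm_insert)
  have a0: "a N n = 0" if "\<not> n \<le> N" for N n using that by (simp add: a_def entropy_coeff_def)
  have a_sq: "(a N k)\<^sup>2 = entropy_coeff N k" for N k
    using nonneg[of N k] by (simp add: a_def)
  \<comment> \<open>Squaring reduces the next two estimates to the entropy bounds at
    \<open>(?r z)\<^sup>2\<close> and \<open>(cmod (z $ i))\<^sup>2\<close>, whose sum is
    \<open>(?R z)\<^sup>2\<close>.\<close>
  have sq: "(a N k * (?r z ^ k * cmod (z $ i) ^ (N - k)))\<^sup>2 =
      entropy_coeff N k * ((?r z)\<^sup>2) ^ k * ((cmod (z $ i))\<^sup>2) ^ (N - k)" for N k z
    by (simp add: power_mult_distrib a_sq mult_ac flip: power_mult)
  have upper: "a N k * (?r z ^ k * cmod (z $ i) ^ (N - k)) \<le> ?R z ^ N" for N k z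
  proof (cases "k \<le> N")
    case True
    have "(a N k * (?r z ^ k * cmod (z $ i) ^ (N - k)))\<^sup>2 \<le> ((?R z)\<^sup>2) ^ N"
      unfolding sq R using True by (intro entropy_coeff_le) auto
    then have "(a N k * (?r z ^ k * cmod (z $ i) ^ (N - k)))\<^sup>2 \<le> (?R z ^ N)\<^sup>2"
      by (simp add: power_mult[symmetric] mult.commute)
    then show ?thesis by (rule power2_le_imp_le) (simp add: subnorm_nonneg)
  qed (simp add: a0 subnorm_nonneg)
  have lower: "\<exists>k\<le>N. ?R z ^ N \<le> 2 * (a N k * (?r z ^ k * cmod (z $ i) ^ (N - k)))" for N z
  proof -
    obtain k where k: "k \<le> N" "((?R z)\<^sup>2) ^ N \<le>
        2 * (entropy_coeff N k * ((?r z)\<^sup>2) ^ k * ((cmod (z $ i))\<^sup>2) ^ (N - k))"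
      using entropy_coeff_ge[of "(?r z)\<^sup>2" "(cmod (z $ i))\<^sup>2" N] unfolding R by auto
    let ?m = "a N k * (?r z ^ k * cmod (z $ i) ^ (N - k))"
    have m: "?m \<ge> 0" by (simp add: nonneg subnorm_nonneg)
    have "(?R z ^ N)\<^sup>2 = ((?R z)\<^sup>2) ^ N" by (simp add: power_mult[symmetric] mult.commute)
    also have "\<dots> \<le> 2 * ?m\<^sup>2" using k unfolding sq by simp
    also have "\<dots> \<le> (2 * ?m)\<^sup>2" by (simp add: power_mult_distrib)
    finally have "?R z ^ N \<le> 2 * ?m" by (rule power2_le_imp_le) (use m in simp)
    with k show ?thesis by blast
  qed
  have ent: "entire (f N l)" if l: "l < J * M" for N l
    unfolding f_def
  proof (rule entire_lac_sum)
    have j: "l div M < J" using l by (rule less_mult_imp_div_less)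
    show "entire (T N n (l div M))" for n
      unfolding T_def by (intro entire_mult entire_power entire_component p j)
    fix B :: real assume B: "B \<ge> 0"
    have "a N n * cmod (T N n (l div M) z) \<le> B ^ N * (a N n * 1 ^ n)" if z: "norm z \<le> B" for n z
    proof (cases "n \<le> N")
      case True
      have "?r z \<le> B" using subnorm_le_norm[of S z] z by linarith
      then have "cmod (p n (l div M) z) \<le> B ^ n"
        using order_trans[OF p(2)[OF j]] power_mono[OF _ subnorm_nonneg] by blast
      moreover have "cmod (z $ i) ^ (N - n) \<le> B ^ (N - n)"
        using Finite_Cartesian_Product.norm_nth_le[of z i] z by (intro power_mono) auto
      ultimately have "cmod (T N n (l div M) z) \<le> B ^ n * B ^ (N - n)"
        unfolding T_def norm_mult norm_power using B by (intro mult_mono) auto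
      also have "\<dots> = B ^ N" using True by (simp flip: power_add)
      finally have "cmod (T N n (l div M) z) \<le> B ^ N" .
      from mult_left_mono[OF this nonneg[of N n]] show ?thesis by (simp add: mult_ac)
    qed (simp add: a0)
    then show "\<exists>s\<ge>0. \<exists>t\<ge>0. \<forall>n z. norm z \<le> B \<longrightarrow> a N n * cmod (T N n (l div M) z) \<le> s * (a N n * t ^ n)"
      using B by (intro exI[of _ "B ^ N"] exI[of _ 1] conjI allI impI) auto
  qed
  have main: "(\<forall>l<J * M. cmod (f N l z) \<le> 768 * ?R z ^ N) \<and>
      \<delta> / 64 * ?R z ^ N \<le> (\<Sum>l<J * M. cmod (f N l z))" if z: "z $ i \<noteq> 0" for N z
  proof -
    define w where "w = cmod (z $ i)"
    have w: "w > 0" using z by (simp add: w_def)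
    \<comment> \<open>With \<open>w ^ N\<close> factored out, the terms in two variables become
      those of a one-variable series at the radius \<open>?r z / w\<close>.\<close>
    have conv: "a N n * (?r z ^ n * w ^ (N - n)) = w ^ N * (a N n * (?r z / w) ^ n)" for n
    proof (cases "n \<le> N")
      case True
      then have "w ^ N = w ^ n * w ^ (N - n)" by (simp flip: power_add)
      then show ?thesis using w by (simp add: power_divide)
    qed (simp add: a0)
    have T: "cmod (T N n j z) = cmod (p n j z) * w ^ (N - n)" for n j
      by (simp add: T_def w_def norm_mult norm_power)
    obtain m where m: "\<And>k. a N k * (?r z / w) ^ k \<le> 16 * (a N m * (?r z / w) ^ m)"
      "\<And>l. l < J * M \<Longrightarrow> cmod (f N l z) \<le> 768 * (w ^ N * (a N m * (?r z / w) ^ m))"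
      "\<delta> / 2 * (w ^ N * (a N m * (?r z / w) ^ m)) \<le> (\<Sum>l<J * M. cmod (f N l z))"
      unfolding f_def
    proof (rule lac_sum_bounds[where s = "w ^ N" and t = "?r z / w" and T = "T N" and z = z,
          OF _ _ _ _ M])
      show "w ^ N \<ge> 0" "?r z / w \<ge> 0" using w by (auto simp: subnorm_nonneg)
      show "a N n * cmod (T N n j z) \<le> w ^ N * (a N n * (?r z / w) ^ n)" if "j < J" for n j
        unfolding T conv[symmetric] using w that
        by (intro mult_left_mono mult_right_mono p nonneg) auto
      show "\<delta> * (w ^ N * (a N n * (?r z / w) ^ n)) \<le> (\<Sum>j<J. a N n * cmod (T N n j z))" for n
      proof -
        have "(a N n * w ^ (N - n)) * (\<delta> * ?r z ^ n) \<le> (a N n * w ^ (N - n)) * (\<Sum>j<J. cmod (p n j z))"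
          using w nonneg[of N n] by (intro mult_left_mono low) auto
        then show ?thesis
          unfolding T conv[symmetric] by (simp add: sum_distrib_left mult_ac)
      qed
    qed (rule that[unfolded f_def])
    let ?m = "w ^ N * (a N m * (?r z / w) ^ m)"
    have "?m \<le> ?R z ^ N" using upper[of N m z] by (simp add: conv flip: w_def)
    moreover obtain k where "?R z ^ N \<le> 2 * (a N k * (?r z ^ k * w ^ (N - k)))"
      using lower[of N z] by (auto simp: w_def)
    then have "?R z ^ N \<le> 2 * (w ^ N * (a N k * (?r z / w) ^ k))" by (simp only: conv)
    moreover have "w ^ N * (a N k * (?r z / w) ^ k) \<le> w ^ N * (16 * (a N m * (?r z / w) ^ m))"
      using w by (intro mult_left_mono m(1)) auto
    ultimately have *: "?m \<le> ?R z ^ N" "?R z ^ N \<le> 32 * ?m" by linarith+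
    \<comment> \<open>The 32 is the 2 from \<open>lower\<close> times the 16 from
      \<open>m(1)\<close>; isolating the dominant term had already halved
      \<open>\<delta>\<close>.\<close>
    have "\<delta> / 64 * ?R z ^ N \<le> \<delta> / 64 * (32 * ?m)" using * \<delta> by (intro mult_left_mono) auto
    also have "\<dots> = \<delta> / 2 * ?m" by simp
    finally have "\<delta> / 64 * ?R z ^ N \<le> (\<Sum>l<J * M. cmod (f N l z))" using m(3) by linarith
    moreover have "cmod (f N l z) \<le> 768 * ?R z ^ N" if "l < J * M" for l
      using m(2)[OF that] * by linarith
    ultimately show ?thesis by blast
  qed
  have cont: "continuous_on UNIV (\<lambda>z. cmod (f N l z))" if "l < J * M" for N l
    using entire_continuous[OF ent[OF that]] by (intro continuous_intros)
  have contR: "continuous_on UNIV (\<lambda>z. c * ?R z ^ N)" for c N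
    by (intro continuous_intros continuous_on_subnorm)
  have up: "cmod (f N l z) \<le> 768 * ?R z ^ N" if "l < J * M" for N l z
    by (rule le_of_nonzero_component[where i = i, OF cont[OF that] contR]) (use main that in blast)
  have lo: "\<delta> / 64 * ?R z ^ N \<le> (\<Sum>l<J * M. cmod (f N l z))" for N z
    by (rule le_of_nonzero_component[where i = i, OF contR continuous_on_sum[OF cont]])
      (use main in auto)
  \<comment> \<open>Dividing by 768 restores the upper constant 1 on which the induction
    relies.\<close>
  define q where "q N l z = 1 / 768 * f N l z" for N l z
  show ?case
  proof (intro exI[of _ "J * M"] exI[of _ "\<delta> / 64 / 768"] exI[of _ q] conjI allI impI)
    show "\<delta> / 64 / 768 > 0" using \<delta> by simp
    show "entire (q N l)" if "l < J * M" for N l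
      unfolding q_def by (intro entire_mult entire_const ent that)
    show "cmod (q N l z) \<le> ?R z ^ N" if "l < J * M" for N l z
      using up[OF that, of N z] by (simp add: q_def norm_mult norm_divide)
    show "\<delta> / 64 / 768 * ?R z ^ N \<le> (\<Sum>l<J * M. cmod (q N l z))" for N z
      using lo[of z N] by (simp add: q_def norm_mult norm_divide field_simps flip: sum_distrib_left sum_divide_distrib)
  qed
qed

section \<open>The associated weight\<close>

lemma weight_minimizer:
  assumes \<omega>: "weight_function \<omega>" and n: "n > 0"
  shows "\<exists>\<tau>>0. \<forall>t\<ge>0. \<omega> \<tau> / \<tau> ^ n * t ^ n \<le> \<omega> t"
proof -
  have pos: "\<omega> t > 0" if "t \<ge> 0" for t using \<omega> that by (auto simp: weight_function_def)
  have mono: "\<omega> s \<le> \<omega> t" if "0 \<le> s" "s \<le> t" for s t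
    using \<omega> that by (auto simp: weight_function_def mono_on_def)
  have cont: "continuous_on {0..} \<omega>" using \<omega> by (auto simp: weight_function_def)
  define V where "V = \<omega> 1"
  \<comment> \<open>For \<open>t < \<epsilon>\<close> one has
    \<open>V * t ^ n \<le> V * \<epsilon> = \<omega> 0 \<le> \<omega> t\<close>, so the quotient is
    at least its value \<open>V\<close> at 1; beyond \<open>T\<close> the growth of
    \<open>\<omega>\<close> gives the same. Minimising over \<open>{\<epsilon>..T}\<close> is
    therefore enough.\<close>
  define \<epsilon> where "\<epsilon> = \<omega> 0 / V"
  have V: "V > 0" by (simp add: V_def pos)
  have \<epsilon>: "0 < \<epsilon>" "\<epsilon> \<le> 1"
    using mono[of 0 1] pos[of 0] V by (auto simp: \<epsilon>_def V_def)
  have "filterlim (\<lambda>t. \<omega> t / t ^ n) at_top at_top"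
    using \<omega> by (auto simp: weight_function_def)
  then have "\<forall>\<^sub>F t in at_top. V \<le> \<omega> t / t ^ n"
    by (simp add: filterlim_at_top)
  then obtain T0 where T0: "\<And>t. t \<ge> T0 \<Longrightarrow> V \<le> \<omega> t / t ^ n"
    by (auto simp: eventually_at_top_linorder)
  define T where "T = max 1 T0"
  have "continuous_on {\<epsilon>..T} (\<lambda>t. \<omega> t / t ^ n)"
    using \<epsilon> by (intro continuous_intros continuous_on_subset[OF cont]) auto
  moreover have "compact {\<epsilon>..T}" "{\<epsilon>..T} \<noteq> {}" using \<epsilon> by (auto simp: T_def)
  ultimately obtain \<tau> where \<tau>: "\<tau> \<in> {\<epsilon>..T}"
    "\<And>t. t \<in> {\<epsilon>..T} \<Longrightarrow> \<omega> \<tau> / \<tau> ^ n \<le> \<omega> t / t ^ n"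
    using continuous_attains_inf[of "{\<epsilon>..T}" "\<lambda>t. \<omega> t / t ^ n"] by blast
  have \<tau>0: "\<tau> > 0" using \<tau>(1) \<epsilon> by simp
  have V': "\<omega> \<tau> / \<tau> ^ n \<le> V"
    using \<tau>(2)[of 1] \<epsilon> by (simp add: T_def V_def)
  have "\<omega> \<tau> / \<tau> ^ n * t ^ n \<le> \<omega> t" if t: "t \<ge> 0" for t
  proof (cases "t = 0")
    case True
    then show ?thesis using n pos[of 0] by (simp add: zero_power less_imp_le)
  next
    case False
    with t have t0: "t > 0" by simp
    have "\<omega> \<tau> / \<tau> ^ n \<le> \<omega> t / t ^ n"
    proof (cases "t < \<epsilon>")
      case True
      have "t ^ n \<le> t ^ 1" using True \<epsilon> t n by (intro power_decreasing) auto
      then have "V * t ^ n \<le> V * \<epsilon>" using True V by (intro mult_left_mono) auto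
      also have "\<dots> \<le> \<omega> t" using mono[of 0 t] t V by (simp add: \<epsilon>_def)
      finally have "V \<le> \<omega> t / t ^ n" using t0 by (simp add: field_simps)
      with V' show ?thesis by linarith
    next
      case False
      then show ?thesis
        using \<tau>(2)[of t] order_trans[OF V' T0[of t]] by (cases "t \<le> T") (auto simp: T_def)
    qed
    then show ?thesis using t0 by (simp add: pos_le_divide_eq)
  qed
  with \<tau>0 show ?thesis by blast
qed

text \<open>The maximum principle for \<open>f w / w ^ n\<close>, which is holomorphic on the
  annulus.\<close>

lemma annulus_bound:
  assumes f: "f holomorphic_on UNIV" and r: "0 < r" "r \<le> cmod z" "cmod z \<le> R"
    and b1: "\<And>w. cmod w = r \<Longrightarrow> cmod (f w) \<le> C * r ^ n"
    and b2: "\<And>w. cmod w = R \<Longrightarrow> cmod (f w) \<le> C * R ^ n"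
  shows "cmod (f z) \<le> C * cmod z ^ n"
proof -
  define S :: "complex set" where "S = cball 0 R - ball 0 r"
  have S: "closed S" "bounded S" by (auto simp: S_def bounded_diff)
  have nz: "w \<noteq> 0" if "w \<in> S" for w using that r by (auto simp: S_def)
  have hol: "(\<lambda>w. f w / w ^ n) holomorphic_on S"
    using nz by (intro holomorphic_intros holomorphic_on_subset[OF f]) auto
  have "cmod (f z / z ^ n) \<le> C"
  proof (rule maximum_modulus_frontier[where S = S and f = "\<lambda>w. f w / w ^ n"])
    show "(\<lambda>w. f w / w ^ n) holomorphic_on interior S"
      using hol interior_subset by (rule holomorphic_on_subset)
    show "continuous_on (closure S) (\<lambda>w. f w / w ^ n)"
      using holomorphic_on_imp_continuous_on[OF hol] S by simp
    show "bounded S" "z \<in> S" using S r by (auto simp: S_def)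
    fix w assume w: "w \<in> frontier S"
    have "ball 0 R - cball 0 r \<subseteq> interior S"
      by (intro interior_maximal open_Diff) (auto simp: S_def)
    moreover have "w \<in> S" "w \<notin> interior S" using w S by (auto simp: frontier_def)
    ultimately have "w \<notin> ball 0 R - cball 0 r" by blast
    then have "cmod w = r \<or> cmod w = R" using \<open>w \<in> S\<close> by (auto simp: S_def)
    then show "cmod (f w / w ^ n) \<le> C"
      using b1[of w] b2[of w] nz[OF \<open>w \<in> S\<close>] by (auto simp: norm_divide norm_power pos_divide_le_eq)
  qed
  moreover have "cmod z ^ n > 0" using r by (intro zero_less_power) linarith
  ultimately show ?thesis by (simp add: norm_divide norm_power pos_divide_le_eq)
qed

text \<open>\<open>\<tau> n\<close> is a minimiser of \<open>\<omega> t / t ^ n\<close>; for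
  \<open>n = 0\<close> it can be 0 by monotonicity, with \<open>0 ^ 0 = 1\<close>. Thus
  \<open>a n * t ^ n\<close> below is the largest multiple of \<open>t ^ n\<close> under
  \<open>\<omega>\<close> and touches it at \<open>\<tau> n\<close>.\<close>

locale weight =
  fixes \<omega> :: "real \<Rightarrow> real" and \<tau> :: "nat \<Rightarrow> real"
  assumes \<omega>: "weight_function \<omega>"
    and \<tau>_0: "\<tau> 0 = 0"
    and \<tau>_pos: "n > 0 \<Longrightarrow> \<tau> n > 0"
    and \<tau>_min: "t \<ge> 0 \<Longrightarrow> \<omega> (\<tau> n) / \<tau> n ^ n * t ^ n \<le> \<omega> t"
begin

definition a :: "nat \<Rightarrow> real" where "a n = \<omega> (\<tau> n) / \<tau> n ^ n"

lemma \<tau>_nonneg: "\<tau> n \<ge> 0"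
  using \<tau>_0 \<tau>_pos[of n] by (cases n) auto

lemma pos: "t \<ge> 0 \<Longrightarrow> \<omega> t > 0"
  using \<omega> by (auto simp: weight_function_def)

lemma mono: "0 \<le> s \<Longrightarrow> s \<le> t \<Longrightarrow> \<omega> s \<le> \<omega> t"
  using \<omega> by (auto simp: weight_function_def mono_on_def)

lemma a_le: "t \<ge> 0 \<Longrightarrow> a n * t ^ n \<le> \<omega> t"
  using \<tau>_min by (simp add: a_def)

lemma \<tau>_power_pos: "\<tau> n ^ n > 0"
  using \<tau>_0 \<tau>_pos[of n] by (cases n) auto

lemma a_\<tau>: "a n * \<tau> n ^ n = \<omega> (\<tau> n)"
  using \<tau>_power_pos[of n] by (simp add: a_def del: power_eq_0_iff zero_less_power_eq)

lemma a_pos: "a n > 0"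
  using \<tau>_power_pos[of n] pos[OF \<tau>_nonneg] by (simp add: a_def)

lemma a_decay: "(\<lambda>n. a n * t ^ n) \<longlonglongrightarrow> 0"
proof (rule Lim_null_comparison)
  define s where "s = \<bar>t\<bar> + 1"
  have "norm (a n * t ^ n) \<le> \<omega> (2 * s) * (1/2) ^ n" for n
  proof -
    have "norm (a n * t ^ n) \<le> a n * s ^ n"
      using a_pos[of n]
      by (auto simp: abs_mult power_abs s_def intro!: mult_left_mono power_mono)
    also have "\<dots> = a n * (2 * s) ^ n * (1/2) ^ n"
      by (simp add: power_mult_distrib power_divide)
    also have "\<dots> \<le> \<omega> (2 * s) * (1/2) ^ n"
      by (intro mult_right_mono a_le) (auto simp: s_def)
    finally show ?thesis .
  qed
  then show "\<forall>\<^sub>F n in sequentially. norm (a n * t ^ n) \<le> \<omega> (2 * s) * (1/2) ^ n"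
    by simp
  show "(\<lambda>n. \<omega> (2 * s) * (1/2) ^ n) \<longlonglongrightarrow> 0"
    by (intro tendsto_mult_right_zero LIMSEQ_realpow_zero) auto
qed

sublocale log_concave a
proof
  fix n
  show "a n \<ge> 0" using a_pos[of n] by simp
  show "a 0 > 0" "a n > 0" using a_pos by auto
  show "(\<lambda>n. a n * t ^ n) \<longlonglongrightarrow> 0" for t by (rule a_decay)
  \<comment> \<open>At this point the middle monomial touches \<open>\<omega>\<close>, while its two
    neighbours stay below.\<close>
  let ?t = "\<tau> (Suc n)"
  have t: "?t > 0" by (simp add: \<tau>_pos)
  have "(a n * ?t ^ n) * (a (Suc (Suc n)) * ?t ^ Suc (Suc n)) \<le> \<omega> ?t * \<omega> ?t"
    using t a_pos pos[of ?t] by (intro mult_mono a_le) (auto simp: less_imp_le)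
  also have "\<dots> = (a (Suc n) * ?t ^ Suc n) * (a (Suc n) * ?t ^ Suc n)"
    by (simp only: a_\<tau>)
  finally have "(a n * a (Suc (Suc n))) * (?t ^ Suc n)\<^sup>2 \<le> (a (Suc n))\<^sup>2 * (?t ^ Suc n)\<^sup>2"
    by (simp add: power2_eq_square algebra_simps)
  then show "a n * a (Suc (Suc n)) \<le> (a (Suc n))\<^sup>2"
    using t by (subst (asm) mult_le_cancel_right_pos) auto
qed

text \<open>A bound \<open>T\<close> for all minimisers would give
  \<open>\<omega> 0 \<le> a n * \<tau> n ^ n \<le> a n * T ^ n\<close>, which tends to 0.\<close>

lemma \<tau>_unbounded: "\<exists>n. T < \<tau> n"
proof (rule ccontr)
  assume "\<nexists>n. T < \<tau> n"
  then have T: "\<tau> n \<le> T" for n by (simp add: not_less)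
  have "\<omega> 0 \<le> a n * T ^ n" for n
  proof -
    have "\<omega> 0 \<le> \<omega> (\<tau> n)" by (intro mono \<tau>_nonneg) auto
    also have "\<dots> = a n * \<tau> n ^ n" by (simp add: a_\<tau>)
    also have "\<dots> \<le> a n * T ^ n"
      using a_pos[of n] by (intro mult_left_mono power_mono T \<tau>_nonneg) auto
    finally show ?thesis .
  qed
  then have "\<omega> 0 \<le> 0"
    using a_decay[of T] by (intro tendsto_lowerbound[OF a_decay[of T]]) auto
  with pos[of 0] show False by simp
qed

lemma bracket:
  assumes "t \<ge> 0"
  obtains n where "\<tau> n \<le> t" "t < \<tau> (Suc n)"
proof -
  define N where "N = (LEAST n. t < \<tau> n)"
  have N: "t < \<tau> N" unfolding N_def by (rule LeastI_ex) (rule \<tau>_unbounded)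
  then have "N \<noteq> 0" using assms \<tau>_0 by (metis not_less)
  moreover have "\<not> t < \<tau> (N - 1)"
    using \<open>N \<noteq> 0\<close> not_less_Least[of "N - 1" "\<lambda>n. t < \<tau> n"] by (auto simp: N_def)
  ultimately show thesis using N that[of "N - 1"] by simp
qed

section \<open>Entire functions of one variable dominated by the weight\<close>

lemma coeff_bound:
  assumes f: "f holomorphic_on UNIV" "\<And>w. cmod (f w) \<le> \<omega> (cmod w)" and r: "r > 0"
  shows "cmod ((deriv ^^ k) f 0 / fact k) \<le> \<omega> r / r ^ k"
proof -
  have "cmod ((deriv ^^ k) f 0) \<le> fact k * \<omega> r / r ^ k"
    using f r by (intro Cauchy_inequality)
      (auto intro: holomorphic_on_subset holomorphic_on_imp_continuous_on)
  then show ?thesis by (simp add: norm_divide field_simps)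
qed

text \<open>Away from the minimisers \<open>\<tau> n\<close>, the Cauchy estimates at the two neighbouring minimisers make
  the Taylor series geometrically dominated by its terms of degree \<open>n\<close> and \<open>n + 1\<close>.\<close>

lemma central_bound:
  assumes f: "f holomorphic_on UNIV" "\<And>w. cmod (f w) \<le> \<omega> (cmod w)"
    and z: "2 * \<tau> n \<le> cmod z" "2 * cmod z \<le> \<tau> (Suc n)" "z \<noteq> 0"
  shows "cmod (f z) \<le> 6 * max (a n * cmod z ^ n) (a (Suc n) * cmod z ^ Suc n)"
proof -
  define t where "t = cmod z"
  define m where "m = max (a n * t ^ n) (a (Suc n) * t ^ Suc n)"
  have t: "t > 0" using z by (simp add: t_def)
  have m: "m \<ge> 0" using a_pos[of n] t by (simp add: m_def le_max_iff_disj)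
  let ?c = "\<lambda>k. (deriv ^^ k) f 0 / fact k * z ^ k"
  \<comment> \<open>The tail decays geometrically from \<open>Suc n\<close>; recentring it at
    \<open>n\<close> costs the factor 2.\<close>
  have "cmod (?c k) \<le> (2 * m) * (1/2) ^ ((k - n) + (n - k))" for k
  proof -
    \<comment> \<open>Degrees up to \<open>n\<close> use the Cauchy radius \<open>\<tau> n\<close>,
      higher ones \<open>\<tau> (Suc n)\<close>. The case \<open>n = k = 0\<close> is separate
      because \<open>\<tau> 0 = 0\<close> is not a radius.\<close>
    consider "k < n" | "n = 0" "k = 0" | "n > 0" "k = n" | "k \<ge> Suc n" by linarith
    then show ?thesis
    proof cases
      case 1
      then have \<tau>: "\<tau> n > 0" by (simp add: \<tau>_pos)
      have "cmod (?c k) \<le> \<omega> (\<tau> n) / \<tau> n ^ k * t ^ k"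
        unfolding norm_mult norm_power t_def
        by (intro mult_right_mono coeff_bound[OF f \<tau>]) auto
      also have "\<dots> = a n * t ^ n * (\<tau> n / t) ^ (n - k)"
        using \<tau> t 1 by (simp add: a_\<tau>[symmetric] power_divide power_diff field_simps)
      also have "\<dots> \<le> m * (1/2) ^ (n - k)"
        using z \<tau> t m by (intro mult_mono power_mono) (auto simp: m_def field_simps t_def)
      also have "\<dots> \<le> (2 * m) * (1/2) ^ (n - k)" using m by (intro mult_right_mono) auto
      finally show ?thesis using 1 by simp
    next
      case 2
      then have "cmod (?c k) \<le> \<omega> 0" using f(2)[of 0] by simp
      also have "\<dots> = a n * t ^ n" using a_\<tau>[of 0] 2 by (simp add: \<tau>_0)
      finally show ?thesis using 2 m by (simp add: m_def)
    next
      case 3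
      then have \<tau>: "\<tau> n > 0" by (simp add: \<tau>_pos)
      have "cmod (?c k) \<le> \<omega> (\<tau> n) / \<tau> n ^ k * t ^ k"
        unfolding norm_mult norm_power t_def
        by (intro mult_right_mono coeff_bound[OF f \<tau>]) auto
      also have "\<dots> = a n * t ^ n" using 3 by (simp add: a_def)
      finally show ?thesis using 3 m by (simp add: m_def)
    next
      case 4
      have \<tau>: "\<tau> (Suc n) > 0" by (simp add: \<tau>_pos)
      have "cmod (?c k) \<le> \<omega> (\<tau> (Suc n)) / \<tau> (Suc n) ^ k * t ^ k"
        unfolding norm_mult norm_power t_def
        by (intro mult_right_mono coeff_bound[OF f \<tau>]) auto
      also have "\<dots> = a (Suc n) * t ^ Suc n * (t / \<tau> (Suc n)) ^ (k - Suc n)"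
        using \<tau> t 4 by (simp add: a_\<tau>[symmetric] power_divide power_diff field_simps)
      also have "\<dots> \<le> m * (1/2) ^ (k - Suc n)"
        using z \<tau> t m by (intro mult_mono power_mono) (auto simp: m_def field_simps t_def)
      also have "(1/2::real) ^ (k - Suc n) = 2 * (1/2) ^ (k - n)"
        using 4 by (auto simp: le_iff_add)
      finally show ?thesis using 4 by simp
    qed
  qed
  then have "cmod (suminf ?c) \<le> 3 * (2 * m)"
    by (rule sums_half_power_dist_bound(2)) (use m in simp)
  moreover have "?c sums f z"
    using holomorphic_power_series[of f 0 "cmod z + 1" z] f(1)
    by (auto intro: holomorphic_on_subset)
  ultimately show ?thesis by (simp add: sums_iff m_def t_def)
qed

text \<open>Far from both neighbouring minimisers \<open>central_bound\<close> applies. Close to one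
  of them, the maximum principle interpolates between its circle, where the monomial equals
  \<open>\<omega>\<close>, and a circle covered by \<open>central_bound\<close>. If their ratio is
  below 4, the annulus between the two suffices.\<close>

lemma monomial_bound:
  assumes f: "f holomorphic_on UNIV" "\<And>w. cmod (f w) \<le> \<omega> (cmod w)"
  shows "\<exists>n. cmod (f z) \<le> 12 * (a n * cmod z ^ n)"
proof -
  define t where "t = cmod z"
  obtain n where n: "\<tau> n \<le> t" "t < \<tau> (Suc n)"
    using bracket[of t] by (auto simp: t_def)
  let ?s = "\<tau> n" and ?T = "\<tau> (Suc n)"
  have T: "?T > 0" by (simp add: \<tau>_pos)
  \<comment> \<open>At \<open>?s\<close> the monomial of degree \<open>n\<close> touches
    \<open>\<omega>\<close>, at \<open>?T\<close> that of degree \<open>Suc n\<close>; comparing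
    there and cancelling gives \<open>up\<close> and \<open>down\<close>.\<close>
  have up: "a (Suc n) * ?s \<le> a n"
  proof -
    have "a (Suc n) * ?s ^ Suc n \<le> a n * ?s ^ n" unfolding a_\<tau> by (rule a_le[OF \<tau>_nonneg])
    then have "(a (Suc n) * ?s) * ?s ^ n \<le> a n * ?s ^ n" by (simp add: mult_ac)
    then show ?thesis using \<tau>_power_pos[of n] by (subst (asm) mult_le_cancel_right_pos)
  qed
  have down: "a n \<le> a (Suc n) * ?T"
  proof -
    have "a n * ?T ^ n \<le> a (Suc n) * ?T ^ Suc n" unfolding a_\<tau> by (rule a_le[OF \<tau>_nonneg])
    then have "a n * ?T ^ n \<le> (a (Suc n) * ?T) * ?T ^ n" by (simp add: mult_ac)
    then show ?thesis using T by (subst (asm) mult_le_cancel_right_pos) auto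
  qed
  have in_s: "cmod (f w) \<le> a n * ?s ^ n" if "cmod w = ?s" for w
    using f(2)[of w] that by (simp add: a_\<tau>)
  have in_T: "cmod (f w) \<le> a (Suc n) * ?T ^ Suc n" if "cmod w = ?T" for w
    using f(2)[of w] that by (simp only: a_\<tau>)
  have weaken: "c * r \<le> d * r" if "c \<le> d" "r \<ge> 0" for c d r :: real
    using that by (rule mult_right_mono)
  consider "t = 0" | "t > 0" "4 * ?s \<le> ?T" "2 * ?s \<le> t" "2 * t \<le> ?T" | "4 * ?s \<le> ?T" "t < 2 * ?s"
    | "4 * ?s \<le> ?T" "?T < 2 * t" | "?T < 4 * ?s"
    using n \<tau>_nonneg[of n] by linarith
  then show ?thesis
  proof cases
    case 1
    then show ?thesis using f(2)[of z] a_\<tau>[of 0] pos[of 0] by (intro exI[of _ 0]) (simp add: t_def \<tau>_0)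
  next
    case 2
    then have "cmod (f z) \<le> 6 * max (a n * t ^ n) (a (Suc n) * t ^ Suc n)"
      unfolding t_def by (intro central_bound f) auto
    also have "\<dots> \<le> 12 * max (a n * t ^ n) (a (Suc n) * t ^ Suc n)"
      using a_pos[of n] \<open>t > 0\<close> by (intro mult_right_mono) (auto simp: le_max_iff_disj)
    finally show ?thesis
      unfolding t_def max_def by (metis (full_types))
  next
    case 3
    then have s: "?s > 0" using n by linarith
    have "cmod (f z) \<le> (12 * a n) * cmod z ^ n"
    proof (rule annulus_bound[where r = ?s and R = "2 * ?s"])
      fix w assume "cmod w = ?s"
      then show "cmod (f w) \<le> (12 * a n) * ?s ^ n"
        using weaken[of "a n" "12 * a n" "?s ^ n"] in_s[of w] \<tau>_power_pos[of n] a_pos[of n]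
        by linarith
    next
      fix w assume w: "cmod w = 2 * ?s"
      have "cmod (f w) \<le> 6 * max (a n * cmod w ^ n) (a (Suc n) * cmod w ^ Suc n)"
        using w 3 s by (intro central_bound f) auto
      \<comment> \<open>By \<open>up\<close> the higher monomial is at most twice the lower one on
        this circle, whence the constant 6 becomes 12.\<close>
      also have "a (Suc n) * cmod w ^ Suc n = (2 * (a (Suc n) * ?s)) * cmod w ^ n"
        by (simp add: w)
      also have "6 * max (a n * cmod w ^ n) \<dots> \<le> 6 * (2 * a n * cmod w ^ n)"
        using up a_pos[of n] by (intro mult_left_mono max.boundedI weaken) auto
      finally show "cmod (f w) \<le> 12 * a n * (2 * ?s) ^ n" using w by (simp add: mult_ac)
    qed (use f s n 3 in \<open>auto simp: t_def\<close>)
    then show ?thesis by (auto simp: mult_ac)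
  next
    case 4
    have "cmod (f z) \<le> (12 * a (Suc n)) * cmod z ^ Suc n"
    proof (rule annulus_bound[where r = "?T / 2" and R = ?T])
      fix w assume "cmod w = ?T"
      then show "cmod (f w) \<le> (12 * a (Suc n)) * ?T ^ Suc n"
        using weaken[of "a (Suc n)" "12 * a (Suc n)" "?T ^ Suc n"] in_T[of w]
          \<tau>_power_pos[of "Suc n"] a_pos[of "Suc n"]
        by linarith
    next
      fix w assume w: "cmod w = ?T / 2"
      have "cmod (f w) \<le> 6 * max (a n * cmod w ^ n) (a (Suc n) * cmod w ^ Suc n)"
        using w 4 T by (intro central_bound f) auto
      also have "\<dots> = 6 * max (a n * cmod w ^ n) ((a (Suc n) * ?T / 2) * cmod w ^ n)"
        by (simp add: w)
      also have "\<dots> \<le> 6 * (a (Suc n) * ?T * cmod w ^ n)"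
        using down a_pos[of "Suc n"] T by (intro mult_left_mono max.boundedI weaken) auto
      also have "\<dots> = 12 * a (Suc n) * (?T / 2) ^ Suc n" by (simp add: w)
      finally show "cmod (f w) \<le> 12 * a (Suc n) * (?T / 2) ^ Suc n" .
    qed (use f T n 4 in \<open>auto simp: t_def\<close>)
    then show ?thesis by (auto simp: mult_ac intro!: exI[of _ "Suc n"])
  next
    case 5
    then have s: "?s > 0" using T by linarith
    have "cmod (f z) \<le> (12 * a n) * cmod z ^ n"
    proof (rule annulus_bound[where r = ?s and R = ?T])
      fix w assume "cmod w = ?s"
      then show "cmod (f w) \<le> (12 * a n) * ?s ^ n"
        using weaken[of "a n" "12 * a n" "?s ^ n"] in_s[of w] \<tau>_power_pos[of n] a_pos[of n]
        by linarith
    next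
      fix w assume w: "cmod w = ?T"
      have "a (Suc n) * ?T \<le> a (Suc n) * (4 * ?s)"
        using a_pos[of "Suc n"] 5 by (intro mult_left_mono) auto
      also have "\<dots> \<le> 12 * a n" using up a_pos[of n] by linarith
      finally have "a (Suc n) * ?T * ?T ^ n \<le> 12 * a n * ?T ^ n" using T by (intro weaken) auto
      then show "cmod (f w) \<le> 12 * a n * ?T ^ n" using in_T[OF w] by (simp add: mult_ac)
    qed (use f s n in \<open>auto simp: t_def\<close>)
    then show ?thesis by (auto simp: mult_ac)
  qed
qed

end

lemma weight_exists:
  assumes "weight_function \<omega>"
  obtains \<tau> where "weight \<omega> \<tau>"
proof -
  obtain \<sigma> where \<sigma>: "\<And>n. n > 0 \<Longrightarrow> \<sigma> n > 0 \<and> (\<forall>t\<ge>0. \<omega> (\<sigma> n) / \<sigma> n ^ n * t ^ n \<le> \<omega> t)"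
    using weight_minimizer[OF assms] by metis
  have "weight \<omega> (\<lambda>n. if n = 0 then 0 else \<sigma> n)"
    using assms \<sigma> by unfold_locales (auto simp: weight_function_def mono_on_def)
  then show thesis by (rule that)
qed

section \<open>Finite families in the growth space\<close>

context weight
begin

text \<open>The members are residue class sums of the lacunary series in
  \<open>a n * p n j z\<close>, with \<open>p\<close> from \<open>bounded_below_family\<close>. Each
  is at most 768 times the dominant monomial, hence at most \<open>768 * \<omega>\<close>; jointly
  they control that monomial.\<close>

lemma growth_space_family:
  obtains J :: nat and C :: real and f :: "nat \<Rightarrow> complex ^ 'n \<Rightarrow> complex"
  where "\<And>j. j < J \<Longrightarrow> f j \<in> growth_space \<omega>" "C > 0"
    "\<And>z n. a n * norm z ^ n \<le> C * (\<Sum>j<J. cmod (f j z))"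
proof -
  from bounded_below_family[OF finite[of "UNIV :: 'n set"]]
  obtain J \<delta> and p :: "nat \<Rightarrow> nat \<Rightarrow> complex ^ 'n \<Rightarrow> complex"
    where family: "\<delta> > 0 \<and>
      (\<forall>n. \<forall>j<J. entire (p n j) \<and> (\<forall>z. cmod (p n j z) \<le> norm z ^ n)) \<and>
      (\<forall>n z. \<delta> * norm z ^ n \<le> (\<Sum>j<J. cmod (p n j z)))"
    unfolding subnorm_UNIV by (elim exE)
  then have \<delta>: "\<delta> > 0"
    and p: "\<And>n j. j < J \<Longrightarrow> entire (p n j)"
      "\<And>n j z. j < J \<Longrightarrow> cmod (p n j z) \<le> norm z ^ n"
    and low: "\<And>n z. \<delta> * norm z ^ n \<le> (\<Sum>j<J. cmod (p n j z))"
    by simp_all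
  obtain M where M: "M > 0" "real J * (768 * (1/2) ^ M) \<le> \<delta> / 2"
    using exists_modulus[OF \<delta>] by blast
  define f where "f = lac_sum a p M"
  have ent: "entire (f l)" if l: "l < J * M" for l
    unfolding f_def
  proof (rule entire_lac_sum)
    have j: "l div M < J" using l by (rule less_mult_imp_div_less)
    show "entire (p n (l div M))" for n by (rule p[OF j])
    fix R :: real assume R: "R \<ge> 0"
    have "a n * cmod (p n (l div M) z) \<le> 1 * (a n * R ^ n)" if "norm z \<le> R" for n z
      using order_trans[OF p(2)[OF j] power_mono[OF that]] nonneg by (auto intro: mult_left_mono)
    then show "\<exists>s\<ge>0. \<exists>t\<ge>0. \<forall>n z. norm z \<le> R \<longrightarrow> a n * cmod (p n (l div M) z) \<le> s * (a n * t ^ n)"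
      using R by (intro exI[of _ 1] exI[of _ R] conjI allI impI) auto
  qed
  have main: "\<exists>m. (\<forall>n. a n * norm z ^ n \<le> 16 * (a m * norm z ^ m)) \<and>
      (\<forall>l<J * M. cmod (f l z) \<le> 768 * (1 * (a m * norm z ^ m))) \<and>
      \<delta> / 2 * (1 * (a m * norm z ^ m)) \<le> (\<Sum>l<J * M. cmod (f l z))" for z
    unfolding f_def
  proof (rule lac_sum_bounds[where s = 1 and t = "norm z" and T = p and z = z, OF _ _ _ _ M])
    show "a n * cmod (p n j z) \<le> 1 * (a n * norm z ^ n)" if "j < J" for n j
      using p(2)[OF that] nonneg by (auto intro: mult_left_mono)
    show "\<delta> * (1 * (a n * norm z ^ n)) \<le> (\<Sum>j<J. a n * cmod (p n j z))" for n
      using mult_left_mono[OF low nonneg, of n z n] by (simp add: sum_distrib_left mult_ac)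
  qed auto
  show thesis
  \<comment> \<open>The constant is 16, for replacing any \<open>n\<close> by the dominant
    \<open>m\<close>, times \<open>2 / \<delta>\<close> from the lower bound.\<close>
  proof (rule that[of "J * M" f "32 / \<delta>"])
    fix l assume l: "l < J * M"
    have "cmod (f l z) / \<omega> (norm z) \<le> 768" for z
    proof -
      obtain m where "cmod (f l z) \<le> 768 * (1 * (a m * norm z ^ m))" using main[of z] l by blast
      also have "\<dots> \<le> 768 * \<omega> (norm z)" using a_le[of "norm z" m] by simp
      finally show ?thesis using pos[of "norm z"] by (simp add: pos_divide_le_eq)
    qed
    then show "f l \<in> growth_space \<omega>"
      using ent[OF l] by (auto simp: growth_space_def intro!: bdd_aboveI)
  next
    show "32 / \<delta> > 0" using \<delta> by simp
    fix z n
    obtain m where m: "a n * norm z ^ n \<le> 16 * (a m * norm z ^ m)"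
      "\<delta> / 2 * (1 * (a m * norm z ^ m)) \<le> (\<Sum>l<J * M. cmod (f l z))"
      using main[of z] by blast
    have "32 / \<delta> * (\<delta> / 2 * (1 * (a m * norm z ^ m))) \<le> 32 / \<delta> * (\<Sum>l<J * M. cmod (f l z))"
      using \<delta> by (intro mult_left_mono m) auto
    moreover have "32 / \<delta> * (\<delta> / 2 * (1 * (a m * norm z ^ m))) = 16 * (a m * norm z ^ m)"
      using \<delta> by simp
    ultimately show "a n * norm z ^ n \<le> 32 / \<delta> * (\<Sum>l<J * M. cmod (f l z))"
      using m(1) by linarith
  qed
qed

section \<open>Continuity of the associated weight and comparison with the growth space\<close>

abbreviation dominated :: "(complex \<Rightarrow> complex) set" where
  "dominated \<equiv> {f. f holomorphic_on UNIV \<and> (\<forall>w. cmod (f w) \<le> \<omega> (cmod w))}"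

lemma assoc_weight_upper:
  assumes "f \<in> dominated"
  shows "cmod (f z) \<le> assoc_weight \<omega> (cmod z)"
  unfolding assoc_weight_cmod
proof (rule cSup_upper)
  show "bdd_above {cmod (f z) |f. f holomorphic_on UNIV \<and> (\<forall>w. cmod (f w) \<le> \<omega> (cmod w))}"
    by (rule bdd_aboveI[of _ "\<omega> (cmod z)"]) auto
qed (use assms in auto)

lemma zero_dominated: "(\<lambda>z. 0) \<in> dominated"
  using pos by (auto intro: less_imp_le)

lemma assoc_weight_least:
  assumes "\<And>f. f \<in> dominated \<Longrightarrow> cmod (f z) \<le> B"
  shows "assoc_weight \<omega> (cmod z) \<le> B"
  unfolding assoc_weight_cmod
proof (rule cSup_least)
  show "{cmod (f z) |f. f holomorphic_on UNIV \<and> (\<forall>w. cmod (f w) \<le> \<omega> (cmod w))} \<noteq> {}"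
    using zero_dominated by blast
qed (use assms in auto)

lemma assoc_weight_nonneg: "t \<ge> 0 \<Longrightarrow> assoc_weight \<omega> t \<ge> 0"
  using assoc_weight_upper[OF zero_dominated, of "complex_of_real t"] by simp

text \<open>By Cauchy estimates on unit circles all competitors share the Lipschitz constant
  \<open>\<omega> (R + 1)\<close> on the disc of radius \<open>R\<close>, and their supremum
  inherits it. The lattice property requires the resulting continuity.\<close>

lemma assoc_weight_lipschitz:
  assumes "0 \<le> s" "s \<le> R" "0 \<le> t" "t \<le> R"
  shows "assoc_weight \<omega> s \<le> assoc_weight \<omega> t + \<omega> (R + 1) * \<bar>s - t\<bar>"
proof -
  have "assoc_weight \<omega> (cmod (complex_of_real s)) \<le> assoc_weight \<omega> t + \<omega> (R + 1) * \<bar>s - t\<bar>"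
  proof (rule assoc_weight_least)
    fix f assume f: "f \<in> dominated"
    then have hol: "f holomorphic_on UNIV" by simp
    have "cmod (f (complex_of_real s) - f (complex_of_real t))
        \<le> \<omega> (R + 1) * cmod (complex_of_real s - complex_of_real t)"
    proof (rule field_differentiable_bound[where S = "cball 0 R"])
      fix z :: complex assume z: "z \<in> cball 0 R"
      have D: "(f has_field_derivative deriv f z) (at z)"
        using hol by (intro holomorphic_derivI[of f UNIV]) auto
      then show "(f has_field_derivative deriv f z) (at z within cball 0 R)"
        by (rule has_field_derivative_at_within)
      show "cmod (deriv f z) \<le> \<omega> (R + 1)"
      proof (rule holomorphic_deriv_bound[OF hol _ D])
        fix w assume "cmod (w - z) = 1"
        then have "cmod w \<le> R + 1" using z norm_triangle_ineq[of "w - z" z] by simp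
        then show "cmod (f w) \<le> \<omega> (R + 1)"
          using f mono[of "cmod w" "R + 1"] order_trans by fastforce
      qed
    qed (use assms in auto)
    then show "cmod (f (complex_of_real s)) \<le> assoc_weight \<omega> t + \<omega> (R + 1) * \<bar>s - t\<bar>"
      using assoc_weight_upper[OF f, of "complex_of_real t"] assms
        norm_triangle_ineq2[of "f (complex_of_real s)" "f (complex_of_real t)"]
      by (simp flip: of_real_diff)
  qed
  then show ?thesis using assms by simp
qed

lemma continuous_on_assoc_weight: "continuous_on {0..} (assoc_weight \<omega>)"
  unfolding continuous_on_iff
proof (intro ballI allI impI)
  fix t e :: real assume t: "t \<in> {0..}" and e: "e > 0"
  define L where "L = \<omega> (t + 1 + 1)"
  have L: "L > 0" using t by (simp add: L_def pos)
  show "\<exists>d>0. \<forall>s\<in>{0..}. dist s t < d \<longrightarrow> dist (assoc_weight \<omega> s) (assoc_weight \<omega> t) < e"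
  proof (intro exI[of _ "min 1 (e / L)"] conjI ballI impI)
    show "min 1 (e / L) > 0" using e L by simp
    fix s assume s: "s \<in> {0..}" "dist s t < min 1 (e / L)"
    then have "s \<le> t + 1" by (simp add: dist_real_def abs_less_iff)
    then have "\<bar>assoc_weight \<omega> s - assoc_weight \<omega> t\<bar> \<le> L * \<bar>s - t\<bar>"
      using s assoc_weight_lipschitz[of s "t + 1" t] assoc_weight_lipschitz[of t "t + 1" s] t
      by (simp add: L_def dist_real_def abs_minus_commute abs_le_iff)
    also have "\<dots> < e" using s L by (simp add: dist_real_def field_simps)
    finally show "dist (assoc_weight \<omega> s) (assoc_weight \<omega> t) < e" by (simp add: dist_real_def)
  qed
qed

text \<open>On the complex line through 0 and \<open>z\<close>, parametrised by a vector of norm at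
  most 1, \<open>f / C\<close> competes in the one-variable supremum because \<open>\<omega>\<close>
  is non-decreasing.\<close>

lemma growth_space_le_assoc_weight:
  fixes f :: "complex ^ 'n \<Rightarrow> complex"
  assumes "f \<in> growth_space \<omega>"
  obtains C where "C > 0" "\<And>z. cmod (f z) \<le> C * assoc_weight \<omega> (norm z)"
proof -
  obtain B where B: "\<And>z. cmod (f z) / \<omega> (norm z) \<le> B"
    using assms by (auto simp: growth_space_def bdd_above_def)
  define C where "C = max 1 B"
  have C: "C > 0" by (simp add: C_def)
  have le: "cmod (f z) \<le> C * \<omega> (norm z)" for z
  proof -
    have "cmod (f z) / \<omega> (norm z) \<le> C" using B[of z] by (simp add: C_def)
    then show ?thesis using pos[of "norm z"] by (simp add: pos_divide_le_eq)
  qed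
  have ent: "entire f" using assms by (simp add: growth_space_def)
  show thesis
  proof (rule that[OF C])
    fix z :: "complex ^ 'n"
    obtain v :: "complex ^ 'n" where v: "norm v \<le> 1" "z = complex_of_real (norm z) *s v"
    proof (cases "z = 0")
      case True
      then show thesis using that[of 0] by simp
    next
      case False
      then show thesis
        using that[of "complex_of_real (1 / norm z) *s z"]
        by (auto simp: norm_vector_scalar_mult norm_divide vector_smult_assoc)
    qed
    define h where "h \<zeta> = f (0 + \<zeta> *s v) / complex_of_real C" for \<zeta>
    have "h \<in> dominated"
    proof safe
      show "h holomorphic_on UNIV"
        unfolding h_def[abs_def] using C
        by (intro holomorphic_on_divide entire_line_holomorphic ent holomorphic_on_const) auto
      fix \<zeta>
      have "norm (\<zeta> *s v) \<le> cmod \<zeta>" using v by (simp add: norm_vector_scalar_mult mult_left_le)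
      then have "C * \<omega> (norm (\<zeta> *s v)) \<le> C * \<omega> (cmod \<zeta>)"
        using C by (intro mult_left_mono mono) auto
      with le[of "\<zeta> *s v"] have "cmod (f (\<zeta> *s v)) \<le> C * \<omega> (cmod \<zeta>)" by (rule order_trans)
      then show "cmod (h \<zeta>) \<le> \<omega> (cmod \<zeta>)"
        using C by (simp add: h_def norm_divide pos_divide_le_eq mult.commute)
    qed
    from assoc_weight_upper[OF this, of "complex_of_real (norm z)"]
    show "cmod (f z) \<le> C * assoc_weight \<omega> (norm z)"
      using C v(2) by (simp add: h_def norm_divide pos_divide_le_eq mult.commute)
  qed
qed

text \<open>\<open>monomial_bound\<close> puts each competitor below a monomial, and
  \<open>growth_space_family\<close> puts all monomials below one sum of moduli.\<close>

lemma assoc_weight_equivalent: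
  obtains J :: nat and C :: real and f :: "nat \<Rightarrow> complex ^ 'n \<Rightarrow> complex"
  where "\<And>j. j < J \<Longrightarrow> f j \<in> growth_space \<omega>" "C > 0"
    "\<And>z. assoc_weight \<omega> (norm z) \<le> C * (\<Sum>j<J. cmod (f j z))"
proof -
  obtain J C and f :: "nat \<Rightarrow> complex ^ 'n \<Rightarrow> complex"
    where f: "\<And>j. j < J \<Longrightarrow> f j \<in> growth_space \<omega>" "C > 0"
      "\<And>z n. a n * norm z ^ n \<le> C * (\<Sum>j<J. cmod (f j z))"
    by (rule growth_space_family) blast
  show thesis
  proof (rule that[of J f "12 * C"])
    fix z :: "complex ^ 'n"
    have "assoc_weight \<omega> (cmod (complex_of_real (norm z))) \<le> 12 * C * (\<Sum>j<J. cmod (f j z))"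
    proof (rule assoc_weight_least)
      fix h assume h: "h \<in> dominated"
      obtain n where "cmod (h (complex_of_real (norm z))) \<le> 12 * (a n * cmod (complex_of_real (norm z)) ^ n)"
        using monomial_bound[of h "complex_of_real (norm z)"] h by auto
      also have "\<dots> \<le> 12 * C * (\<Sum>j<J. cmod (f j z))" using f(3)[of n z] by simp
      finally show "cmod (h (complex_of_real (norm z))) \<le> 12 * C * (\<Sum>j<J. cmod (f j z))" .
    qed
    then show "assoc_weight \<omega> (norm z) \<le> 12 * C * (\<Sum>j<J. cmod (f j z))" by simp
  qed (use f in auto)
qed

end

section \<open>Lattices and the weighted composition operator\<close>

lemma lattice_sum:
  assumes L: "lattice L" and F: "\<And>j. j < J \<Longrightarrow> F j \<in> L"
  shows "(\<lambda>z. \<Sum>j<(J::nat). F j z) \<in> L"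
  using F
proof (induction J)
  case 0
  then show ?case using L by (simp add: lattice_def)
next
  case (Suc J)
  then show ?case using L unfolding lattice_def by simp
qed

lemma lattice_dominated:
  assumes "lattice L" "continuous_on UNIV f" "continuous_on UNIV F"
    "\<And>z. cmod (f z) \<le> cmod (F z)" "F \<in> L"
  shows "f \<in> L"
  using assms unfolding lattice_def by blast

lemma lattice_scale: "lattice L \<Longrightarrow> F \<in> L \<Longrightarrow> (\<lambda>z. c * F z) \<in> L"
  unfolding lattice_def by blast

lemma holomorphic_map_continuous: "holomorphic_map \<phi> \<Longrightarrow> continuous_on S \<phi>"
  using continuous_on_vec_lambda[of S "\<lambda>i z. \<phi> z $ i"]
  by (simp add: holomorphic_map_def entire_continuous)

theorem theorem1p2:
  fixes \<omega> :: "real \<Rightarrow> real"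
    and g :: "complex ^ 'n \<Rightarrow> complex"
    and \<phi> :: "complex ^ 'n \<Rightarrow> complex ^ 'n"
    and L :: "(complex ^ 'n \<Rightarrow> complex) set"
  assumes "weight_function \<omega>"
    and "entire g"
    and "holomorphic_map \<phi>"
    and "lattice L"
  shows "weighted_composition g \<phi> ` growth_space \<omega> \<subseteq> L \<longleftrightarrow>
         (\<lambda>z. complex_of_real (cmod (g z) * assoc_weight \<omega> (norm (\<phi> z)))) \<in> L"
proof -
  let ?lhs = "weighted_composition g \<phi> ` growth_space \<omega> \<subseteq> L"
  let ?W = "\<lambda>z. complex_of_real (cmod (g z) * assoc_weight \<omega> (norm (\<phi> z)))"
  obtain \<tau> where "weight \<omega> \<tau>" using weight_exists[OF assms(1)] .
  then interpret weight \<omega> \<tau> .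
  have cg: "continuous_on UNIV g" using assms(2) by (rule entire_continuous)
  have c\<phi>: "continuous_on UNIV \<phi>" using assms(3) by (rule holomorphic_map_continuous)
  have cf: "continuous_on UNIV (weighted_composition g \<phi> f)" if "f \<in> growth_space \<omega>" for f
    unfolding weighted_composition_def
    using that by (intro continuous_intros cg continuous_on_compose2[OF entire_continuous c\<phi>])
      (auto simp: growth_space_def)
  have cW: "continuous_on UNIV ?W"
    by (intro continuous_intros cg continuous_on_compose2[OF continuous_on_assoc_weight] c\<phi>) auto
  show ?thesis
  proof
    assume lhs: ?lhs
    obtain J C and f :: "nat \<Rightarrow> complex ^ 'n \<Rightarrow> complex"
      where f: "\<And>j. j < J \<Longrightarrow> f j \<in> growth_space \<omega>" "C > 0"
        "\<And>z. assoc_weight \<omega> (norm z) \<le> C * (\<Sum>j<J. cmod (f j z))"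
      by (rule assoc_weight_equivalent) blast
    \<comment> \<open>Moduli are taken before summing, as the functions themselves might cancel;
      each modulus lies in \<open>L\<close> by the lattice property.\<close>
    let ?F = "\<lambda>j z. complex_of_real (cmod (weighted_composition g \<phi> (f j) z))"
    have cF: "continuous_on UNIV (?F j)" if "j < J" for j
      by (intro continuous_intros cf f that)
    have "?F j \<in> L" if "j < J" for j
      using lhs f(1)[OF that]
      by (intro lattice_dominated[OF assms(4) cF[OF that] cf[OF f(1)[OF that]]]) auto
    then have "(\<lambda>z. complex_of_real C * (\<Sum>j<J. ?F j z)) \<in> L"
      by (intro lattice_scale lattice_sum assms)
    then show "?W \<in> L"
    proof (rule lattice_dominated[OF assms(4) cW, rotated 2])
      show "continuous_on UNIV (\<lambda>z. complex_of_real C * (\<Sum>j<J. ?F j z))"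
        by (intro continuous_on_mult_left continuous_on_sum cF) auto
      fix z
      have "cmod (g z) * assoc_weight \<omega> (norm (\<phi> z)) \<le> cmod (g z) * (C * (\<Sum>j<J. cmod (f j (\<phi> z))))"
        by (intro mult_left_mono f) auto
      also have "\<dots> = C * (\<Sum>j<J. cmod (weighted_composition g \<phi> (f j) z))"
        by (simp add: weighted_composition_def norm_mult sum_distrib_left mult_ac)
      also have "\<dots> = cmod (complex_of_real C * (\<Sum>j<J. ?F j z))"
        using f(2) by (simp add: norm_mult sum_nonneg flip: of_real_sum)
      finally show "cmod (?W z) \<le> cmod (complex_of_real C * (\<Sum>j<J. ?F j z))"
        using assoc_weight_nonneg[of "norm (\<phi> z)"] by (simp add: norm_mult)
    qed
  next
    assume W: "?W \<in> L"
    show ?lhs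
    proof safe
      fix f :: "complex ^ 'n \<Rightarrow> complex" assume f: "f \<in> growth_space \<omega>"
      obtain C where C: "C > 0" "\<And>z. cmod (f z) \<le> C * assoc_weight \<omega> (norm z)"
        by (rule growth_space_le_assoc_weight[OF f]) blast
      show "weighted_composition g \<phi> f \<in> L"
      proof (rule lattice_dominated[OF assms(4) cf[OF f] _ _ lattice_scale[OF assms(4) W]])
        show "continuous_on UNIV (\<lambda>z. complex_of_real C * ?W z)"
          by (intro continuous_on_mult_left cW)
        fix z
        have "cmod (g z) * cmod (f (\<phi> z)) \<le> cmod (g z) * (C * assoc_weight \<omega> (norm (\<phi> z)))"
          by (intro mult_left_mono C) auto
        then show "cmod (weighted_composition g \<phi> f z) \<le> cmod (complex_of_real C * ?W z)"
          using C(1) assoc_weight_nonneg[of "norm (\<phi> z)"]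
          by (simp add: weighted_composition_def norm_mult mult_ac)
      qed
    qed
  qed
qed

end
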